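(* Let $\mathcal{E}$ be a finite biordered set, and let $\mathbf{u}=(i_1,a_1,\lambda_1)\dots(i_m,a_m,\lambda_m)$ and $\mathbf{v}=(j_1,b_1,\mu_1)\dots(j_m,b_m,\mu_m)$ be two elements of $\mathsf{IG}(\mathcal{E})$ of $\mathscr{D}$-fingerprint $(D_1,\dots,D_m)$, where $D_k$ has maximal subgroup $G_k$. Let $L\leq G_1$ be a subgroup and $x\in G_1$. For $1\leq k<m$ let $\mathcal{T}_k$ be the class of tall subgroups of $G_k\times G_{k+1}^\partial$, i.e. subgroups of the form $H\times G_{k+1}$ for a finitely generated $H\leq G_k$. (1) $(Lx,\mathbf{u},\mathbf{v})\theta$ is either empty, or a left coset of a subgroup $M$ of $G_m$. (2) If for all $1\leq k<m$ the group $G_k\times G_{k+1}^\partial$ has the $(W_{(\lambda_k,i_{k+1})},\mathcal{T}_k)$-relative Howson property, and $L$ is finitely generated, then either $(Lx,\mathbf{u},\mathbf{v})\theta=\varnothing$, or the subgroup $M$ from (1) is finitely generated as well. (3) If for all $1\leq k<m$ the property $\mathsf{eRHP}(G_k\times G_{k+1}^\partial, W_{(\lambda_k,i_{k+1})},\mathcal{T}_k)$ holds and there is an algorithm solving $\mathsf{RCIP}(G_k\times G_{k+1}^\partial, W_{(\lambda_k,i_{k+1})},\mathcal{T}_k)$, then $(Lx,\mathbf{u},\mathbf{v})\theta$ is effectively computable, i.e., there is an algorithm which, given a finite generating set of $L$ and $x\in G_1$, decides if $(Lx,\mathbf{u},\mathbf{v})\theta=\varnothing$, and in the case of a negative answer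 outputs a finite generating set for $M$ and $y\in G_m$ such that $(Lx,\mathbf{u},\mathbf{v})\theta=yM$.
   Context: Biordered sets and $\mathsf{IG}(\mathcal{E})$. For a semigroup $S$ with set of idempotents $E(S)$, $\mathcal{E}_S$ is the partial algebra on $E(S)$ retaining the product $ef$ exactly when $\{ef,fe\}\cap\{e,f\}\neq\varnothing$ (then both $ef,fe$ are idempotents, and $\{e,f\}$ is called a basic pair). A biordered set is a partial algebra $\mathcal{E}=(E,\cdot)$ isomorphic to some $\mathcal{E}_S$. The free idempotent generated semigroup is $\mathsf{IG}(\mathcal{E})=\langle \overline{E}\mid \overline{e}\,\overline{f}=\overline{e\cdot f}\text{ whenever }\{e,f\}\text{ is a basic pair in }\mathcal{E}\rangle$, $\overline E=\{\overline e:e\in E\}$. For a word $w=e_1\dots e_n\in E^+$ put $\overline{w}=\overline{e_1}\dots\overline{e_n}\in\mathsf{IG}(\mathcal{E})$. Triples. For finite $\mathcal{E}$, every regular $\mathscr{D}$-class $D$ of $\mathsf{IG}(\mathcal{E})$ is a $\mathscr{J}$-class with completely $0$-simple principal factor; for each $D$ fix an identification of this principal factor with a Rees matrix semigroup $\mathcal{M}^0[G;I,\Lambda;P]$, where $G$ is (isomorphic to) the maximal subgroup of $D$, and $I,\Lambda$ are finite sets indexing the $\mathscr{R}$- and $\mathscr{L}$-classes of $D$. Elements of $D$ are thus written as triples $(i,g,\lambda)$, $i\in I$, $g\in G$, $\lambda\in\Lambda$. The groups $G$ are finitely presented. For $D_k$ the data are denoted $G_k,I_k,\Lambda_k$. Juxtaposed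 triples are multiplied in $\mathsf{IG}(\mathcal{E})$. Fingerprints. An r-factorisation of $w\in E^+$ is a factorisation $w=w_1\dots w_m$ into nonempty words with every $\overline{w_i}$ regular in $\mathsf{IG}(\mathcal{E})$; it is minimal if $\overline{w_i\dots w_j}$ is non-regular whenever $i<j$. The sequence $(D_{\overline{w_1}},\dots,D_{\overline{w_m}})$ of $\mathscr{D}$-classes for a minimal r-factorisation depends only on the element $\overline{w}$, and is its $\mathscr{D}$-fingerprint. Writing $\mathbf{u}=(i_1,a_1,\lambda_1)\dots(i_m,a_m,\lambda_m)$ for an element of $\mathscr{D}$-fingerprint $(D_1,\dots,D_m)$ means that there is a word $p_1\dots p_m$ representing $\mathbf{u}$, written as a minimal r-factorisation, with $\overline{p_k}=(i_k,a_k,\lambda_k)\in D_k$ for all $k$. Contact automaton. $G^\partial$ is the dual group of $G$, with $g\ast h=hg$. For $e\in E$, $i\in I_k$: if $\overline{e}(i,g,\lambda)\in D_k$ for some (equivalently all) $g,\lambda$, there are unique $\sigma_e^{(k)}i\in I_k$ and $\alpha_k(e,i)\in G_k$ with $\overline{e}(i,g,\lambda)=(\sigma_e^{(k)}i,\alpha_k(e,i)g,\lambda)$ for all $g,\lambda$; otherwise $\sigma_e^{(k)}i$ is undefined. Dually, if $(i,g,\lambda)\overline{e}\in D_k$ then $(i,g,\lambda)\overline{e}=(i,g\beta_k(\lambda,e),\lambda\tau_e^{(k)})$; otherwise $\lambda\tau^{(k)}_e$ is undefined. For regular $\mathscr{D}$-classes $D_1,D_2$ the contact automaton $\mathcal{A}(D_1,D_2)$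 has vertex set $\Lambda_1\times I_2$ and an edge labelled by $e$ from $(\lambda,i)$ to $(\mu,j)$ iff either (a) $\lambda=\mu\tau_e^{(1)}$ and $\sigma_e^{(2)}i=j$, or (b) $\lambda\tau_e^{(1)}=\mu$ and $i=\sigma_e^{(2)}j$. The group label of the edge, in $G_1\times G_2^\partial$, is $(\beta_1(\mu,e)^{-1},\alpha_2(e,i))$ in case (a) and $(\beta_1(\lambda,e),\alpha_2(e,j)^{-1})$ in case (b); edges may be traversed in both directions, with inverse labels. The label of a walk is the product in $G_1\times G_2^\partial$ of its edge labels in order (the empty walk has label $(1,1)$). The vertex group $W_{(\lambda,i)}\leq G_1\times G_2^\partial$ is the (finitely generated) group of labels of all closed walks based at $(\lambda,i)$. Here $W_{(\lambda_k,i_{k+1})}$ is the vertex group in $\mathcal{A}(D_k,D_{k+1})$. The map $\theta$. For $A\subseteq G_1$, define $A_k\subseteq G_k$, $1\le k\le m$, by $A_1=A$; $B_{1,2}=(A\times G_2)\cap W_{(\lambda_1,i_2)}g_{1,2}$; for $1<k<m$, $B_{k,k+1}=(a_k^{-1}A_k^{-1}b_k\times G_{k+1})\cap W_{(\lambda_k,i_{k+1})}g_{k,k+1}$; and $A_{k+1}=B_{k,k+1}\pi_2$ (second projection) for $1\le k<m$. Here $g_{k,k+1}$ is the label of any fixed walk from $(\lambda_k,i_{k+1})$ to $(\mu_k,j_{k+1})$ in $\mathcal{A}(D_k,D_{k+1})$; if there is no such walk, $B_{k,k+1}=\varnothing$. Then $(A,\mathbf{u},\mathbf{v})\theta=A_m\subseteq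 G_m$. Relative properties. Let $G$ be a finitely generated group, $H\le G$ finitely generated, $\mathcal{K}$ a family of finitely generated subgroups of $G$. $G$ has the $(H,\mathcal{K})$-relative Howson property if $H\cap K$ is finitely generated for every $K\in\mathcal{K}$. $\mathsf{eRHP}(G,H,\mathcal{K})$ asserts this property together with the existence of an algorithm which, given a finite generating set of $K\in\mathcal{K}$, computes a finite generating set of $H\cap K$. $\mathsf{RCIP}(G,H,\mathcal{K})$ is the problem: given (a finite generating set of) $K\in\mathcal{K}$ and $x,y\in G$ (elements being given as words over generators), decide if $Hx\cap Ky=\varnothing$, and if it is non-empty compute a representative of this right coset of $H\cap K$. *)

theory Defs
  imports "HOL-Algebra.Generated_Groups" "HOL-Library.Nat_Bijection"
begin

section \<open>Semigroups and Green's relations\<close>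

record 'a semigrp = "'a partial_object" +
  smul :: "'a \<Rightarrow> 'a \<Rightarrow> 'a"  (infixl \<open>\<odot>\<index>\<close> 70)

definition is_semigroup :: "'a semigrp \<Rightarrow> bool" where
  "is_semigroup S \<longleftrightarrow>
     (\<forall>x\<in>carrier S. \<forall>y\<in>carrier S. x \<odot>\<^bsub>S\<^esub> y \<in> carrier S) \<and>
     (\<forall>x\<in>carrier S. \<forall>y\<in>carrier S. \<forall>z\<in>carrier S.
        (x \<odot>\<^bsub>S\<^esub> y) \<odot>\<^bsub>S\<^esub> z = x \<odot>\<^bsub>S\<^esub> (y \<odot>\<^bsub>S\<^esub> z))"

definition semigroup_iso :: "'a semigrp \<Rightarrow> 'b semigrp \<Rightarrow> ('a \<Rightarrow> 'b) \<Rightarrow> bool" where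
  "semigroup_iso S T f \<longleftrightarrow> bij_betw f (carrier S) (carrier T) \<and>
     (\<forall>x\<in>carrier S. \<forall>y\<in>carrier S. f (x \<odot>\<^bsub>S\<^esub> y) = f x \<odot>\<^bsub>T\<^esub> f y)"

definition idempotents :: "'a semigrp \<Rightarrow> 'a set" where
  "idempotents S = {e \<in> carrier S. e \<odot>\<^bsub>S\<^esub> e = e}"

definition regular_elem :: "'a semigrp \<Rightarrow> 'a \<Rightarrow> bool" where
  "regular_elem S a \<longleftrightarrow> a \<in> carrier S \<and> (\<exists>x\<in>carrier S. a \<odot>\<^bsub>S\<^esub> x \<odot>\<^bsub>S\<^esub> a = a)"

text \<open>The principal one-sided ideals \<open>S\<^sup>1 a\<close> and \<open>a S\<^sup>1\<close>.\<close>

definition left_ideal :: "'a semigrp \<Rightarrow> 'a \<Rightarrow> 'a set" where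
  "left_ideal S a = insert a {s \<odot>\<^bsub>S\<^esub> a |s. s \<in> carrier S}"

definition right_ideal :: "'a semigrp \<Rightarrow> 'a \<Rightarrow> 'a set" where
  "right_ideal S a = insert a {a \<odot>\<^bsub>S\<^esub> s |s. s \<in> carrier S}"

definition greenL :: "'a semigrp \<Rightarrow> ('a \<times> 'a) set" where
  "greenL S = {(a, b). a \<in> carrier S \<and> b \<in> carrier S \<and> left_ideal S a = left_ideal S b}"

definition greenR :: "'a semigrp \<Rightarrow> ('a \<times> 'a) set" where
  "greenR S = {(a, b). a \<in> carrier S \<and> b \<in> carrier S \<and> right_ideal S a = right_ideal S b}"

definition greenD :: "'a semigrp \<Rightarrow> ('a \<times> 'a) set" where
  "greenD S = greenL S O greenR S"

definition Dclass :: "'a semigrp \<Rightarrow> 'a \<Rightarrow> 'a set" where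
  "Dclass S a = greenD S `` {a}"

definition regular_Dclass :: "'a semigrp \<Rightarrow> 'a set \<Rightarrow> bool" where
  "regular_Dclass S D \<longleftrightarrow> (\<exists>a. regular_elem S a \<and> D = Dclass S a)"


section \<open>Biordered sets and the free idempotent generated semigroup\<close>

record 'e palg = "'e partial_object" +
  pprod :: "'e \<Rightarrow> 'e \<Rightarrow> 'e option"

definition idem_palg :: "'s semigrp \<Rightarrow> 's palg" where
  "idem_palg S = \<lparr> carrier = idempotents S,
     pprod = (\<lambda>e f. if e \<in> idempotents S \<and> f \<in> idempotents S \<and>
                       {e \<odot>\<^bsub>S\<^esub> f, f \<odot>\<^bsub>S\<^esub> e} \<inter> {e, f} \<noteq> {}
                    then Some (e \<odot>\<^bsub>S\<^esub> f) else None) \<rparr>"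

definition palg_iso :: "'e palg \<Rightarrow> 's palg \<Rightarrow> ('e \<Rightarrow> 's) \<Rightarrow> bool" where
  "palg_iso E F \<phi> \<longleftrightarrow> bij_betw \<phi> (carrier E) (carrier F) \<and>
     (\<forall>e\<in>carrier E. \<forall>f\<in>carrier E.
        set_option (pprod E e f) \<subseteq> carrier E \<and>
        pprod F (\<phi> e) (\<phi> f) = map_option \<phi> (pprod E e f))"

text \<open>HOL cannot quantify over types inside a formula, so the type \<open>'s\<close> of the ambient
  semigroup is a parameter. Left as a type variable in the hypothesis of a theorem, it ranges
  over all types, i.e. the ambient semigroup is arbitrary.\<close>

definition biordered_set :: "'s itself \<Rightarrow> 'e palg \<Rightarrow> bool" where
  "biordered_set (_ :: 's itself) E \<longleftrightarrow>
     (\<exists>(S :: 's semigrp) \<phi>. is_semigroup S \<and> palg_iso E (idem_palg S) \<phi>)"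

definition basic_pair :: "'e palg \<Rightarrow> 'e \<Rightarrow> 'e \<Rightarrow> bool" where
  "basic_pair E e f \<longleftrightarrow> e \<in> carrier E \<and> f \<in> carrier E \<and>
     (\<exists>g h. pprod E e f = Some g \<and> pprod E f e = Some h \<and> {g, h} \<inter> {e, f} \<noteq> {})"

definition nonempty_words :: "'e palg \<Rightarrow> 'e list set" where
  "nonempty_words E = lists (carrier E) - {[]}"

inductive_set ig_cong :: "'e palg \<Rightarrow> ('e list \<times> 'e list) set" for E :: "'e palg" where
  rel: "basic_pair E e f \<Longrightarrow> pprod E e f = Some g \<Longrightarrow> ([e, f], [g]) \<in> ig_cong E"
| refl: "w \<in> nonempty_words E \<Longrightarrow> (w, w) \<in> ig_cong E"
| sym: "(v, w) \<in> ig_cong E \<Longrightarrow> (w, v) \<in> ig_cong E"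
| trans: "(u, v) \<in> ig_cong E \<Longrightarrow> (v, w) \<in> ig_cong E \<Longrightarrow> (u, w) \<in> ig_cong E"
| mult: "(u, v) \<in> ig_cong E \<Longrightarrow> (u', v') \<in> ig_cong E \<Longrightarrow> (u @ u', v @ v') \<in> ig_cong E"

definition IG :: "'e palg \<Rightarrow> 'e list set semigrp" where
  "IG E = \<lparr> carrier = nonempty_words E // ig_cong E,
            smul = (\<lambda>A B. \<Union>u\<in>A. \<Union>v\<in>B. ig_cong E `` {u @ v}) \<rparr>"

definition wbar :: "'e palg \<Rightarrow> 'e list \<Rightarrow> 'e list set" where
  "wbar E w = ig_cong E `` {w}"


section \<open>Rees matrix coordinates\<close>

text \<open>In \<open>rees_matrix0\<close> and \<open>principal_factor0\<close> the element \<open>None\<close> is the zero, and an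
  entry \<open>None\<close> of the sandwich matrix is a zero entry. A zero is adjoined to the principal
  factor of the minimal ideal too, where the sandwich matrix then has no zero entry.\<close>

definition rees_matrix0 ::
  "('g, 'b) monoid_scheme \<Rightarrow> 'i set \<Rightarrow> 'l set \<Rightarrow> ('l \<Rightarrow> 'i \<Rightarrow> 'g option) \<Rightarrow>
   ('i \<times> 'g \<times> 'l) option semigrp" where
  "rees_matrix0 G I \<Lambda> P =
     \<lparr> carrier = insert None (Some ` (I \<times> carrier G \<times> \<Lambda>)),
       smul = (\<lambda>s t. case (s, t) of
           (Some (i, g, l), Some (j, h, \<mu>)) \<Rightarrow>
              map_option (\<lambda>p. (i, g \<otimes>\<^bsub>G\<^esub> p \<otimes>\<^bsub>G\<^esub> h, \<mu>)) (P l j)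
         | _ \<Rightarrow> None) \<rparr>"

definition principal_factor0 :: "'a semigrp \<Rightarrow> 'a set \<Rightarrow> 'a option semigrp" where
  "principal_factor0 S D =
     \<lparr> carrier = insert None (Some ` D),
       smul = (\<lambda>s t. case (s, t) of
           (Some x, Some y) \<Rightarrow> (if x \<odot>\<^bsub>S\<^esub> y \<in> D then Some (x \<odot>\<^bsub>S\<^esub> y) else None)
         | _ \<Rightarrow> None) \<rparr>"

record ('g, 'i, 'l, 'a) coords =
  grp :: "'g monoid"
  rows :: "'i set"
  cols :: "'l set"
  sandwich :: "'l \<Rightarrow> 'i \<Rightarrow> 'g option"
  triple :: "'i \<times> 'g \<times> 'l \<Rightarrow> 'a"

text \<open>An identification of the principal factor of \<open>D\<close> with \<open>\<M>\<^sup>0[G; I, \<Lambda>; P]\<close>. Every row and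
  every column of \<open>P\<close> has a non-zero entry, as the principal factor is completely 0-simple.\<close>

definition rees_coordinates :: "'a semigrp \<Rightarrow> 'a set \<Rightarrow> ('g, 'i, 'l, 'a) coords \<Rightarrow> bool" where
  "rees_coordinates S D K \<longleftrightarrow>
     group (grp K) \<and> finite (rows K) \<and> finite (cols K) \<and>
     (\<forall>l\<in>cols K. \<forall>i\<in>rows K. set_option (sandwich K l i) \<subseteq> carrier (grp K)) \<and>
     (\<forall>l\<in>cols K. \<exists>i\<in>rows K. sandwich K l i \<noteq> None) \<and>
     (\<forall>i\<in>rows K. \<exists>l\<in>cols K. sandwich K l i \<noteq> None) \<and>
     semigroup_iso (rees_matrix0 (grp K) (rows K) (cols K) (sandwich K))
                   (principal_factor0 S D) (map_option (triple K))"


section \<open>Fingerprints\<close>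

definition factor_range :: "(nat \<Rightarrow> 'e list) \<Rightarrow> nat \<Rightarrow> nat \<Rightarrow> 'e list" where
  "factor_range p k n = concat (map p [k..<Suc n])"

definition minimal_r_factorisation :: "'e palg \<Rightarrow> nat \<Rightarrow> (nat \<Rightarrow> 'e list) \<Rightarrow> bool" where
  "minimal_r_factorisation E m p \<longleftrightarrow>
     (\<forall>k\<in>{1..m}. p k \<in> nonempty_words E \<and> regular_elem (IG E) (wbar E (p k))) \<and>
     (\<forall>k n. 1 \<le> k \<and> k < n \<and> n \<le> m \<longrightarrow>
        \<not> regular_elem (IG E) (wbar E (factor_range p k n)))"

text \<open>\<open>u = (i\<^sub>1, a\<^sub>1, \<lambda>\<^sub>1) \<dots> (i\<^sub>m, a\<^sub>m, \<lambda>\<^sub>m)\<close> has fingerprint \<open>(D\<^sub>1, \<dots>, D\<^sub>m)\<close>; here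
  \<open>C K\<close> is the coordinate system fixed for the class \<open>K\<close>, and all sequences are indexed
  by \<open>{1..m}\<close>.\<close>

definition fingerprint_product ::
  "'e palg \<Rightarrow> ('e list set set \<Rightarrow> ('g, 'i, 'l, 'e list set) coords) \<Rightarrow> nat \<Rightarrow>
   (nat \<Rightarrow> 'e list set set) \<Rightarrow> (nat \<Rightarrow> 'i \<times> 'g \<times> 'l) \<Rightarrow> 'e list set \<Rightarrow> bool" where
  "fingerprint_product E C m D t u \<longleftrightarrow>
     (\<forall>k\<in>{1..m}. t k \<in> rows (C (D k)) \<times> carrier (grp (C (D k))) \<times> cols (C (D k))) \<and>
     (\<exists>p. minimal_r_factorisation E m p \<and> u = wbar E (factor_range p 1 m) \<and>
        (\<forall>k\<in>{1..m}. Dclass (IG E) (wbar E (p k)) = D k \<and>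
                     wbar E (p k) = triple (C (D k)) (t k)))"


section \<open>The contact automaton\<close>

definition dual_group :: "('g, 'b) monoid_scheme \<Rightarrow> ('g, 'b) monoid_scheme" where
  "dual_group G = G\<lparr> mult := (\<lambda>g h. h \<otimes>\<^bsub>G\<^esub> g) \<rparr>"

text \<open>\<open>left_act E K e i i' x\<close> states \<open>e (i, g, l) = (i', x g, l)\<close> for all \<open>g\<close> and \<open>l\<close>;
  dually for \<open>right_act\<close>.\<close>

definition left_act ::
  "'e palg \<Rightarrow> ('g, 'i, 'l, 'e list set) coords \<Rightarrow> 'e \<Rightarrow> 'i \<Rightarrow> 'i \<Rightarrow> 'g \<Rightarrow> bool" where
  "left_act E K e i i' x \<longleftrightarrow> i' \<in> rows K \<and> x \<in> carrier (grp K) \<and>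
     (\<forall>g\<in>carrier (grp K). \<forall>l\<in>cols K.
        wbar E [e] \<odot>\<^bsub>IG E\<^esub> triple K (i, g, l) = triple K (i', x \<otimes>\<^bsub>grp K\<^esub> g, l))"

definition right_act ::
  "'e palg \<Rightarrow> ('g, 'i, 'l, 'e list set) coords \<Rightarrow> 'l \<Rightarrow> 'e \<Rightarrow> 'l \<Rightarrow> 'g \<Rightarrow> bool" where
  "right_act E K l e l' x \<longleftrightarrow> l' \<in> cols K \<and> x \<in> carrier (grp K) \<and>
     (\<forall>i\<in>rows K. \<forall>g\<in>carrier (grp K).
        triple K (i, g, l) \<odot>\<^bsub>IG E\<^esub> wbar E [e] = triple K (i, g \<otimes>\<^bsub>grp K\<^esub> x, l'))"

context
  fixes E :: "'e palg"
    and C :: "'e list set set \<Rightarrow> ('g, 'i, 'l, 'e list set) coords"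
begin

definition sigma :: "'e list set set \<Rightarrow> 'e \<Rightarrow> 'i \<Rightarrow> 'i option" where
  "sigma D e i =
     (if \<exists>g\<in>carrier (grp (C D)). \<exists>l\<in>cols (C D).
           wbar E [e] \<odot>\<^bsub>IG E\<^esub> triple (C D) (i, g, l) \<in> D
      then Some (THE i'. \<exists>x. left_act E (C D) e i i' x) else None)"

definition alpha :: "'e list set set \<Rightarrow> 'e \<Rightarrow> 'i \<Rightarrow> 'g" where
  "alpha D e i = (THE x. \<exists>i'. left_act E (C D) e i i' x)"

definition tau :: "'e list set set \<Rightarrow> 'l \<Rightarrow> 'e \<Rightarrow> 'l option" where
  "tau D l e =
     (if \<exists>i\<in>rows (C D). \<exists>g\<in>carrier (grp (C D)).
           triple (C D) (i, g, l) \<odot>\<^bsub>IG E\<^esub> wbar E [e] \<in> D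
      then Some (THE l'. \<exists>x. right_act E (C D) l e l' x) else None)"

definition beta :: "'e list set set \<Rightarrow> 'l \<Rightarrow> 'e \<Rightarrow> 'g" where
  "beta D l e = (THE x. \<exists>l'. right_act E (C D) l e l' x)"

definition contact_group :: "'e list set set \<Rightarrow> 'e list set set \<Rightarrow> ('g \<times> 'g) monoid" where
  "contact_group D\<^sub>1 D\<^sub>2 = grp (C D\<^sub>1) \<times>\<times> dual_group (grp (C D\<^sub>2))"

inductive contact_edge ::
  "'e list set set \<Rightarrow> 'e list set set \<Rightarrow> 'l \<times> 'i \<Rightarrow> 'e \<Rightarrow> 'g \<times> 'g \<Rightarrow> 'l \<times> 'i \<Rightarrow> bool"
  for D\<^sub>1 D\<^sub>2 where
  case_a: "\<lbrakk>e \<in> carrier E; l \<in> cols (C D\<^sub>1); \<mu> \<in> cols (C D\<^sub>1); i \<in> rows (C D\<^sub>2); j \<in> rows (C D\<^sub>2);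
     tau D\<^sub>1 \<mu> e = Some l; sigma D\<^sub>2 e i = Some j\<rbrakk> \<Longrightarrow>
     contact_edge D\<^sub>1 D\<^sub>2 (l, i) e (inv\<^bsub>grp (C D\<^sub>1)\<^esub> (beta D\<^sub>1 \<mu> e), alpha D\<^sub>2 e i) (\<mu>, j)"
| case_b: "\<lbrakk>e \<in> carrier E; l \<in> cols (C D\<^sub>1); \<mu> \<in> cols (C D\<^sub>1); i \<in> rows (C D\<^sub>2); j \<in> rows (C D\<^sub>2);
     tau D\<^sub>1 l e = Some \<mu>; sigma D\<^sub>2 e j = Some i\<rbrakk> \<Longrightarrow>
     contact_edge D\<^sub>1 D\<^sub>2 (l, i) e (beta D\<^sub>1 l e, inv\<^bsub>grp (C D\<^sub>2)\<^esub> (alpha D\<^sub>2 e j)) (\<mu>, j)"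

text \<open>\<open>contact_walk D\<^sub>1 D\<^sub>2 v x w\<close>: there is a walk from \<open>v\<close> to \<open>w\<close> with label \<open>x\<close>.\<close>

inductive contact_walk ::
  "'e list set set \<Rightarrow> 'e list set set \<Rightarrow> 'l \<times> 'i \<Rightarrow> 'g \<times> 'g \<Rightarrow> 'l \<times> 'i \<Rightarrow> bool"
  for D\<^sub>1 D\<^sub>2 where
  empty: "v \<in> cols (C D\<^sub>1) \<times> rows (C D\<^sub>2) \<Longrightarrow>
     contact_walk D\<^sub>1 D\<^sub>2 v \<one>\<^bsub>contact_group D\<^sub>1 D\<^sub>2\<^esub> v"
| forward: "contact_edge D\<^sub>1 D\<^sub>2 v e x v' \<Longrightarrow> contact_walk D\<^sub>1 D\<^sub>2 v' y w \<Longrightarrow>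
     contact_walk D\<^sub>1 D\<^sub>2 v (x \<otimes>\<^bsub>contact_group D\<^sub>1 D\<^sub>2\<^esub> y) w"
| backward: "contact_edge D\<^sub>1 D\<^sub>2 v' e x v \<Longrightarrow> contact_walk D\<^sub>1 D\<^sub>2 v' y w \<Longrightarrow>
     contact_walk D\<^sub>1 D\<^sub>2 v (inv\<^bsub>contact_group D\<^sub>1 D\<^sub>2\<^esub> x \<otimes>\<^bsub>contact_group D\<^sub>1 D\<^sub>2\<^esub> y) w"

definition vertex_group ::
  "'e list set set \<Rightarrow> 'e list set set \<Rightarrow> 'l \<times> 'i \<Rightarrow> ('g \<times> 'g) set" where
  "vertex_group D\<^sub>1 D\<^sub>2 v = {x. contact_walk D\<^sub>1 D\<^sub>2 v x v}"

text \<open>The right coset \<open>W\<^sub>v g\<close> for the label \<open>g\<close> of some walk from \<open>v\<close> to \<open>w\<close> (the coset does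
  not depend on the walk), and the empty set if there is no walk.\<close>

definition walk_coset ::
  "'e list set set \<Rightarrow> 'e list set set \<Rightarrow> 'l \<times> 'i \<Rightarrow> 'l \<times> 'i \<Rightarrow> ('g \<times> 'g) set" where
  "walk_coset D\<^sub>1 D\<^sub>2 v w =
     (if \<exists>g. contact_walk D\<^sub>1 D\<^sub>2 v g w
      then vertex_group D\<^sub>1 D\<^sub>2 v #>\<^bsub>contact_group D\<^sub>1 D\<^sub>2\<^esub> (SOME g. contact_walk D\<^sub>1 D\<^sub>2 v g w)
      else {})"


section \<open>The map theta\<close>

abbreviation (input) row_of :: "'i \<times> 'g \<times> 'l \<Rightarrow> 'i" where "row_of t \<equiv> fst t"
abbreviation (input) val_of :: "'i \<times> 'g \<times> 'l \<Rightarrow> 'g" where "val_of t \<equiv> fst (snd t)"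
abbreviation (input) col_of :: "'i \<times> 'g \<times> 'l \<Rightarrow> 'l" where "col_of t \<equiv> snd (snd t)"

text \<open>\<open>theta_B D s t k X\<close> is \<open>B\<^bsub>k,k+1\<^esub>\<close> computed from \<open>X = A\<^sub>k\<close>, where \<open>s k = (i\<^sub>k, a\<^sub>k, \<lambda>\<^sub>k)\<close>
  and \<open>t k = (j\<^sub>k, b\<^sub>k, \<mu>\<^sub>k)\<close>.\<close>

definition theta_B ::
  "(nat \<Rightarrow> 'e list set set) \<Rightarrow> (nat \<Rightarrow> 'i \<times> 'g \<times> 'l) \<Rightarrow> (nat \<Rightarrow> 'i \<times> 'g \<times> 'l) \<Rightarrow>
   nat \<Rightarrow> 'g set \<Rightarrow> ('g \<times> 'g) set" where
  "theta_B D s t k X =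
     (let G = grp (C (D k));
          Y = (if k = 1 then X
               else {inv\<^bsub>G\<^esub> (val_of (s k)) \<otimes>\<^bsub>G\<^esub> inv\<^bsub>G\<^esub> x \<otimes>\<^bsub>G\<^esub> val_of (t k) |x. x \<in> X})
      in (Y \<times> carrier (grp (C (D (Suc k))))) \<inter>
         walk_coset (D k) (D (Suc k)) (col_of (s k), row_of (s (Suc k)))
                                      (col_of (t k), row_of (t (Suc k))))"

text \<open>\<open>theta_A D s t A k\<close> is \<open>A\<^sub>k\<close> for \<open>k \<ge> 1\<close>; the value at \<open>0\<close> is not used.\<close>

primrec theta_A ::
  "(nat \<Rightarrow> 'e list set set) \<Rightarrow> (nat \<Rightarrow> 'i \<times> 'g \<times> 'l) \<Rightarrow> (nat \<Rightarrow> 'i \<times> 'g \<times> 'l) \<Rightarrow>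
   'g set \<Rightarrow> nat \<Rightarrow> 'g set" where
  "theta_A D s t A 0 = {}"
| "theta_A D s t A (Suc k) = (if k = 0 then A else snd ` theta_B D s t k (theta_A D s t A k))"

definition theta ::
  "nat \<Rightarrow> (nat \<Rightarrow> 'e list set set) \<Rightarrow> (nat \<Rightarrow> 'i \<times> 'g \<times> 'l) \<Rightarrow> (nat \<Rightarrow> 'i \<times> 'g \<times> 'l) \<Rightarrow>
   'g set \<Rightarrow> 'g set" where
  "theta m D s t A = theta_A D s t A m"

end


section \<open>Partial recursive functions\<close>

text \<open>The partial recursive functions in their unary presentation: tuples of arguments are
  coded by the Cantor pairing function, whose inverses are among the initial functions.
  \<open>None\<close> is divergence.\<close>

inductive partial_recursive :: "(nat \<Rightarrow> nat option) \<Rightarrow> bool" where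
  zero: "partial_recursive (\<lambda>n. Some 0)"
| succ: "partial_recursive (\<lambda>n. Some (Suc n))"
| left: "partial_recursive (\<lambda>n. Some (fst (prod_decode n)))"
| right: "partial_recursive (\<lambda>n. Some (snd (prod_decode n)))"
| pair: "partial_recursive f \<Longrightarrow> partial_recursive g \<Longrightarrow>
    partial_recursive
      (\<lambda>n. Option.bind (f n) (\<lambda>a. Option.bind (g n) (\<lambda>b. Some (prod_encode (a, b)))))"
| comp: "partial_recursive f \<Longrightarrow> partial_recursive g \<Longrightarrow>
    partial_recursive (\<lambda>n. Option.bind (g n) f)"
| prim_rec: "partial_recursive f \<Longrightarrow> partial_recursive g \<Longrightarrow>
    partial_recursive (\<lambda>n. case prod_decode n of (x, y) \<Rightarrow>
      rec_nat (f x)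
        (\<lambda>k r. Option.bind r (\<lambda>z. g (prod_encode (x, prod_encode (k, z))))) y)"
| minimise: "partial_recursive f \<Longrightarrow>
    partial_recursive (\<lambda>n.
      if \<exists>y. f (prod_encode (n, y)) = Some 0 \<and> (\<forall>z<y. f (prod_encode (n, z)) \<noteq> None)
      then Some (LEAST y. f (prod_encode (n, y)) = Some 0) else None)"


section \<open>Finitely generated groups and algorithmic problems\<close>

definition fin_gen :: "('a, 'b) monoid_scheme \<Rightarrow> 'a set \<Rightarrow> bool" where
  "fin_gen G H \<longleftrightarrow> (\<exists>X. finite X \<and> X \<subseteq> carrier G \<and> H = generate G X)"

definition gen_list :: "('a, 'b) monoid_scheme \<Rightarrow> 'a list \<Rightarrow> bool" where
  "gen_list G X \<longleftrightarrow> set X \<subseteq> carrier G \<and> generate G (set X) = carrier G"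

text \<open>Group words: the letter \<open>(n, False)\<close> stands for the \<open>n\<close>-th generator and \<open>(n, True)\<close>
  for its inverse.\<close>

type_synonym gword = "(nat \<times> bool) list"

definition gword_over :: "'a list \<Rightarrow> gword \<Rightarrow> bool" where
  "gword_over X w \<longleftrightarrow> (\<forall>(n, b)\<in>set w. n < length X)"

definition gword_val :: "('a, 'b) monoid_scheme \<Rightarrow> 'a list \<Rightarrow> gword \<Rightarrow> 'a" where
  "gword_val G X w =
     foldr (\<lambda>(n, b) g. (if b then inv\<^bsub>G\<^esub> (X ! n) else X ! n) \<otimes>\<^bsub>G\<^esub> g) w \<one>\<^bsub>G\<^esub>"

definition gword_span :: "('a, 'b) monoid_scheme \<Rightarrow> 'a list \<Rightarrow> gword list \<Rightarrow> 'a set" where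
  "gword_span G X ws = generate G (gword_val G X ` set ws)"

definition gword_code :: "gword \<Rightarrow> nat" where
  "gword_code w = list_encode (map (\<lambda>(n, b). prod_encode (n, of_bool b)) w)"

definition gwords_code :: "gword list \<Rightarrow> nat" where
  "gwords_code ws = list_encode (map gword_code ws)"

definition rel_Howson :: "('a, 'b) monoid_scheme \<Rightarrow> 'a set \<Rightarrow> 'a set set \<Rightarrow> bool" where
  "rel_Howson G H \<K> \<longleftrightarrow> (\<forall>K\<in>\<K>. fin_gen G (H \<inter> K))"

text \<open>The algorithms below are promise algorithms: nothing is required on inputs that do not
  present an instance. A finite generating set of \<open>G\<close> is chosen in the definitions of
  \<open>eRHP\<close> and \<open>RCIP\<close>; words over one finite generating set translate effectively into words
  over any other, so the choice is immaterial.\<close>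

definition eRHP :: "('a, 'b) monoid_scheme \<Rightarrow> 'a set \<Rightarrow> 'a set set \<Rightarrow> bool" where
  "eRHP G H \<K> \<longleftrightarrow> rel_Howson G H \<K> \<and>
     (\<exists>X f. gen_list G X \<and> partial_recursive f \<and>
        (\<forall>ws. (\<forall>w\<in>set ws. gword_over X w) \<and> gword_span G X ws \<in> \<K> \<longrightarrow>
           (\<exists>ws'. f (gwords_code ws) = Some (gwords_code ws') \<and>
                  (\<forall>w\<in>set ws'. gword_over X w) \<and>
                  gword_span G X ws' = H \<inter> gword_span G X ws)))"

text \<open>Output \<open>0\<close> means that the intersection is empty, output \<open>Suc c\<close> that \<open>c\<close> codes a
  word for one of its elements.\<close>

definition RCIP :: "('a, 'b) monoid_scheme \<Rightarrow> 'a set \<Rightarrow> 'a set set \<Rightarrow> bool" where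
  "RCIP G H \<K> \<longleftrightarrow>
     (\<exists>X f. gen_list G X \<and> partial_recursive f \<and>
        (\<forall>ws x y. (\<forall>w\<in>set ws. gword_over X w) \<and> gword_over X x \<and> gword_over X y \<and>
                  gword_span G X ws \<in> \<K> \<longrightarrow>
           (let Z = (H #>\<^bsub>G\<^esub> gword_val G X x) \<inter> (gword_span G X ws #>\<^bsub>G\<^esub> gword_val G X y);
                r = f (prod_encode (gwords_code ws, prod_encode (gword_code x, gword_code y)))
            in if Z = {} then r = Some 0
               else \<exists>z. r = Some (Suc (gword_code z)) \<and> gword_over X z \<and> gword_val G X z \<in> Z)))"

definition tall_subgroups ::
  "('a, 'b) monoid_scheme \<Rightarrow> ('c, 'd) monoid_scheme \<Rightarrow> ('a \<times> 'c) set set" where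
  "tall_subgroups G G' = {H \<times> carrier G' |H. subgroup H G \<and> fin_gen G H}"

text \<open>\<open>left_coset_computable G G' F\<close>: for all finite generating lists \<open>X\<close> of \<open>G\<close> and \<open>X'\<close> of
  \<open>G'\<close> there is an algorithm which, given words over \<open>X\<close> for a finite generating set of a
  subgroup \<open>L\<close> of \<open>G\<close> and for an element \<open>x\<close>, decides whether \<open>F (L x)\<close> is empty (output \<open>0\<close>),
  and otherwise outputs words over \<open>X'\<close> for a finite generating set of a subgroup \<open>M\<close> of \<open>G'\<close>
  and for an element \<open>y\<close> with \<open>F (L x) = y M\<close>.\<close>

definition left_coset_computable ::
  "('a, 'b) monoid_scheme \<Rightarrow> ('c, 'd) monoid_scheme \<Rightarrow> ('a set \<Rightarrow> 'c set) \<Rightarrow> bool" where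
  "left_coset_computable G G' F \<longleftrightarrow>
     (\<forall>X X'. gen_list G X \<and> gen_list G' X' \<longrightarrow>
        (\<exists>f. partial_recursive f \<and>
           (\<forall>ws x. (\<forall>w\<in>set ws. gword_over X w) \<and> gword_over X x \<longrightarrow>
              (let Z = F (gword_span G X ws #>\<^bsub>G\<^esub> gword_val G X x);
                   r = f (prod_encode (gwords_code ws, gword_code x))
               in if Z = {} then r = Some 0
                  else \<exists>ws' y. r = Some (Suc (prod_encode (gwords_code ws', gword_code y))) \<and>
                         (\<forall>w\<in>set ws'. gword_over X' w) \<and> gword_over X' y \<and>
                         Z = gword_val G' X' y <#\<^bsub>G'\<^esub> gword_span G' X' ws'))))"

end

(* By induction on k every A_k is empty or a left coset, i.e. a right coset in the dual group of
   G_k. The inverse map is a homomorphism from the dual group to the group, and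
   a^-1 z^-1 b = (a^-1 z^-1 a) (a^-1 b), so the first factor of the product that defines B_{k,k+1}
   is then empty or a right coset L x. Since L x \<times> G_{k+1} is a coset of the tall subgroup
   L \<times> G_{k+1}, its intersection with a coset of the vertex group W is empty or a coset of
   W \<inter> (L \<times> G_{k+1}), and the projection of this coset to the dual group of G_{k+1} is A_{k+1}.
   Every step transports finite generation and is effective on words. *)
theory Submission
  imports Defs
begin

section \<open>Computable functions\<close>

text \<open>The contact automaton pairs \<open>G_k\<close> with the dual of \<open>G_{k+1}\<close>,
  so projection changes the side on which cosets are taken, and the inversion at the start of the
  next step changes it back. For \<open>m = 1\<close> neither happens, and \<open>L x\<close> has to
  be rewritten as \<open>x (x^-1 L x)\<close>. For (3), RCIP yields a representative of an
  intersection of cosets and eRHP yields generators of the intersection of the subgroups; neither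
  alone describes the resulting coset. The obstacle is coordination: each of these algorithms comes
  with its own generating list, while the conclusion is required for all lists of \<open>G_1\<close>
  and \<open>G_m\<close>. Everything is therefore phrased as maps between words over fixed lists,
  and data independent of the input (words for generators, for a walk label, the existence of a
  walk) are hard-wired instead of computed. Lists for the intermediate groups are projections of
  lists for the direct products. \<open>alpha\<close> and \<open>beta\<close> are definite
  descriptions. That edge labels are group elements, and hence that vertex groups are subgroups,
  rests on how a single letter multiplies a regular D-class.\<close>

definition computable :: "(nat \<Rightarrow> nat) \<Rightarrow> bool" where
  "computable F \<longleftrightarrow> partial_recursive (\<lambda>n. Some (F n))"

named_theorems computable_intros

lemma computable_comp:
  assumes "computable f" "computable g"
  shows "computable (\<lambda>n. f (g n))"
  using partial_recursive.comp[of "\<lambda>n. Some (f n)" "\<lambda>n. Some (g n)"] assms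
  by (simp add: computable_def)

lemma computable_Suc [computable_intros]:
  "computable f \<Longrightarrow> computable (\<lambda>n. Suc (f n))"
  using computable_comp[of Suc f] partial_recursive.succ by (simp add: computable_def)

lemma computable_fst [computable_intros]:
  "computable f \<Longrightarrow> computable (\<lambda>n. fst (prod_decode (f n)))"
  using computable_comp[of "\<lambda>n. fst (prod_decode n)" f] partial_recursive.left
  by (simp add: computable_def)

lemma computable_snd [computable_intros]:
  "computable f \<Longrightarrow> computable (\<lambda>n. snd (prod_decode (f n)))"
  using computable_comp[of "\<lambda>n. snd (prod_decode n)" f] partial_recursive.right
  by (simp add: computable_def)

lemma computable_pair [computable_intros]:
  "computable f \<Longrightarrow> computable g \<Longrightarrow> computable (\<lambda>n. prod_encode (f n, g n))"
  using partial_recursive.pair[of "\<lambda>n. Some (f n)" "\<lambda>n. Some (g n)"]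
  by (simp add: computable_def)

lemma computable_id [computable_intros]: "computable (\<lambda>n. n)"
proof -
  have "computable (\<lambda>n. prod_encode (fst (prod_decode n), snd (prod_decode n)))"
    by (intro computable_pair)
      (simp_all add: computable_def partial_recursive.left partial_recursive.right)
  then show ?thesis by simp
qed

lemma computable_const [computable_intros]: "computable (\<lambda>n. c)"
proof (induction c)
  case 0
  then show ?case using partial_recursive.zero by (simp add: computable_def)
qed (rule computable_Suc)

text \<open>All functions are unary, so computability of the step in its three arguments is
  expressed on one coded triple \<open>(n, k, r)\<close>, which is the argument that
  \<open>prim_rec\<close> passes.\<close>

lemma computable_rec_nat [computable_intros]:
  assumes "computable f"
    and "computable (\<lambda>p. g (fst (prod_decode p)) (fst (prod_decode (snd (prod_decode p))))
                           (snd (prod_decode (snd (prod_decode p)))))"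
    and "computable a"
  shows "computable (\<lambda>n. rec_nat (f n) (\<lambda>k r. g n k r) (a n))"
proof -
  let ?g = "\<lambda>p. g (fst (prod_decode p)) (fst (prod_decode (snd (prod_decode p))))
                   (snd (prod_decode (snd (prod_decode p))))"
  have rec: "rec_nat (Some (f x)) (\<lambda>k r. Option.bind r
          (\<lambda>z. Some (?g (prod_encode (x, prod_encode (k, z)))))) y
      = Some (rec_nat (f x) (\<lambda>k r. g x k r) y)" for x y
    by (induction y) auto
  have "computable (\<lambda>n. rec_nat (f (fst (prod_decode n))) (\<lambda>k r. g (fst (prod_decode n)) k r)
     (snd (prod_decode n)))"
    using partial_recursive.prim_rec[of "\<lambda>n. Some (f n)" "\<lambda>n. Some (?g n)"] assms
    unfolding computable_def rec by (simp add: case_prod_beta)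
  from computable_comp[OF this computable_pair[OF computable_id assms(3)]] show ?thesis
    by simp
qed

lemma computable_pred [computable_intros]:
  assumes "computable f"
  shows "computable (\<lambda>n. f n - 1)"
proof -
  have "rec_nat 0 (\<lambda>k r. k) y = y - 1" for y :: nat by (cases y) auto
  moreover have "computable (\<lambda>n. rec_nat 0 (\<lambda>k r. k) (f n))"
    by (intro computable_intros assms)
  ultimately show ?thesis by simp
qed

text \<open>Branching is recursion along \<open>c n\<close>: the base value is \<open>f n\<close>,
  and every iteration overwrites the accumulator by \<open>g n\<close>.\<close>

lemma computable_if_zero [computable_intros]:
  assumes "computable c" "computable f" "computable g"
  shows "computable (\<lambda>n. if c n = 0 then f n else g n)"
proof -
  have "rec_nat u (\<lambda>k r. v) y = (if y = 0 then u else v)" for u v y :: nat by (cases y) auto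
  moreover have "computable (\<lambda>n. rec_nat (f n) (\<lambda>k r. g n) (c n))"
    by (intro computable_intros assms computable_comp[OF assms(3)])
  ultimately show ?thesis by simp
qed

text \<open>Here \<open>g\<close> may diverge, so it must not be evaluated when
  \<open>c n = 0\<close>. It is placed in the step of a primitive recursion of length 0 or
  1.\<close>

lemma partial_recursive_if_zero:
  assumes "partial_recursive g" "computable c"
  shows "partial_recursive (\<lambda>n. if c n = 0 then Some 0 else g n)"
proof -
  have "partial_recursive (\<lambda>n. Option.bind (Some (fst (prod_decode n))) g)"
    by (intro partial_recursive.comp assms partial_recursive.left)
  then have *: "partial_recursive (\<lambda>n. case prod_decode n of (x, y) \<Rightarrow> rec_nat (Some 0)
      (\<lambda>k r. Option.bind r (\<lambda>z. Option.bind (Some (fst (prod_decode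
         (prod_encode (x, prod_encode (k, z)))))) g)) y)"
    by (intro partial_recursive.prim_rec partial_recursive.zero)
  have "computable (\<lambda>n. prod_encode (n, if c n = 0 then 0 else 1))"
    by (intro computable_intros assms(2))
  then have "partial_recursive (\<lambda>n. Some (prod_encode (n, if c n = 0 then 0 else 1)))"
    by (simp only: computable_def)
  from partial_recursive.comp[OF * this] show ?thesis
    by (rule arg_cong[where f = partial_recursive, THEN iffD1, rotated]) (auto simp: fun_eq_iff)
qed

text \<open>Induction on the bound: the shift \<open>\<lambda>n. h (Suc n)\<close> has a smaller
  bound, and branching on zero recovers \<open>h\<close> from the shift and the constant
  \<open>h 0\<close>.\<close>

lemma computable_finite_support:
  assumes "\<And>n. n \<ge> N \<Longrightarrow> h n = 0"
  shows "computable h"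
  using assms
proof (induction N arbitrary: h)
  case 0
  then have "h = (\<lambda>n. 0)" by auto
  then show ?case by (simp add: computable_const)
next
  case (Suc N)
  have "computable (\<lambda>n. h (Suc n))" by (rule Suc.IH) (simp add: Suc.prems)
  note pred = computable_comp[OF this computable_pred[OF computable_id]]
  have "computable (\<lambda>n. if n = 0 then h 0 else h (Suc (n - 1)))"
    by (intro computable_if_zero computable_id computable_const pred)
  moreover have "(if n = 0 then h 0 else h (Suc (n - 1))) = h n" for n by simp
  ultimately show ?case by simp
qed

text \<open>This makes non-constructive choices harmless: finitely many values picked by choice can
  be built into an algorithm.\<close>

lemma computable_finite_table:
  assumes "finite A"
  obtains T where "computable T" "\<And>n. n \<in> A \<Longrightarrow> T n = h n"
proof -
  obtain N where N: "\<forall>n\<in>A. n < N" using assms finite_nat_set_iff_bounded by auto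
  have "computable (\<lambda>n. if n < N then h n else 0)"
    by (rule computable_finite_support[of N]) simp
  then show ?thesis using N by (intro that[of "\<lambda>n. if n < N then h n else 0"]) auto
qed

section \<open>Recursion over coded lists\<close>

lemma length_le_list_encode: "length xs \<le> list_encode xs"
proof (induction xs)
  case (Cons x xs)
  have "list_encode xs \<le> prod_encode (x, list_encode xs)" by (rule le_prod_encode_2)
  with Cons.IH show ?case by simp
qed simp

(* The code of a list bounds its length, so it can serve as the number of iterations; the
   surplus iterations leave the state unchanged. *)
lemma computable_foldl [computable_intros]:
  assumes "computable f"
    and "computable (\<lambda>p. g (fst (prod_decode p)) (fst (prod_decode (snd (prod_decode p))))
                           (snd (prod_decode (snd (prod_decode p)))))"
    and "computable a"
  shows "computable (\<lambda>n. foldl (\<lambda>r x. g n r x) (f n) (list_decode (a n)))"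
proof -
  \<comment> \<open>The state is the pair of the code of the remaining list and the accumulator.
    Code 0 is the empty list; any other code is the successor of the pair of head and coded tail,
    hence the subtraction of 1.\<close>
  define step where "step = (\<lambda>n s. if fst (prod_decode s) = 0 then s else
     prod_encode (snd (prod_decode (fst (prod_decode s) - 1)),
       g n (snd (prod_decode s)) (fst (prod_decode (fst (prod_decode s) - 1)))))"
  have step: "step n (prod_encode (list_encode xs, r)) =
      (case xs of [] \<Rightarrow> prod_encode (0, r) | x # ys \<Rightarrow> prod_encode (list_encode ys, g n r x))"
    for n xs r by (cases xs) (auto simp: step_def)
  have iter: "snd (prod_decode (rec_nat (prod_encode (list_encode xs, r)) (\<lambda>k s. step n s) y))
      = foldl (\<lambda>r x. g n r x) r xs" if "length xs \<le> y" for n xs r y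
    using that
  proof (induction y arbitrary: xs r)
    case (Suc y)
    \<comment> \<open>\<open>rec_nat\<close> unfolds at its last iteration, but the list is consumed
      from the first. The step ignores the counter, so the first iteration can be split off
      instead.\<close>
    have *: "rec_nat s (\<lambda>k s. step n s) (Suc y) = rec_nat (step n s) (\<lambda>k s. step n s) y" for s
      by (induction y) auto
    show ?case
      using Suc.IH[of "tl xs"] Suc.prems Suc.IH[of "[]"]
      unfolding * step by (cases xs) auto
  qed simp
  have c: "computable (\<lambda>p. step (fst (prod_decode p)) (snd (prod_decode (snd (prod_decode p)))))"
    unfolding step_def
    by (intro computable_intros computable_comp[OF assms(2), of "\<lambda>p. prod_encode (u p,
       prod_encode (v p, w p))" for u v w, simplified])
  have "computable (\<lambda>n. snd (prod_decode (rec_nat (prod_encode (a n, f n)) (\<lambda>k s. step n s) (a n))))"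
    by (intro computable_intros assms c)
  moreover have "snd (prod_decode (rec_nat (prod_encode (a n, f n)) (\<lambda>k s. step n s) (a n)))
     = foldl (\<lambda>r x. g n r x) (f n) (list_decode (a n))" for n
    using iter[of "list_decode (a n)" "a n" "f n" n] length_le_list_encode[of "list_decode (a n)"] by simp
  ultimately show ?thesis by simp
qed

lemma computable_list_Cons [computable_intros]:
  assumes "computable f" "computable g"
  shows "computable (\<lambda>n. list_encode (f n # list_decode (g n)))"
  using assms by (auto intro: computable_intros)

text \<open>Folding with Cons reverses a list; append and map are obtained from such a fold with a
  second reversal.\<close>

lemma computable_rev [computable_intros]:
  assumes "computable f"
  shows "computable (\<lambda>n. list_encode (rev (list_decode (f n))))"
proof -
  have *: "foldl (\<lambda>r x. list_encode (x # list_decode r)) (list_encode ys) xs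
      = list_encode (rev xs @ ys)" for xs ys
    by (induction xs arbitrary: ys) (simp_all del: list_encode.simps)
  have "computable (\<lambda>n. foldl (\<lambda>r x. list_encode (x # list_decode r)) (list_encode [])
      (list_decode (f n)))"
    by (intro computable_intros assms)
  then show ?thesis unfolding * by simp
qed

lemma computable_append [computable_intros]:
  assumes "computable f" "computable g"
  shows "computable (\<lambda>n. list_encode (list_decode (f n) @ list_decode (g n)))"
proof -
  have "foldl (\<lambda>r x. list_encode (x # list_decode r)) (list_encode ys) xs = list_encode (rev xs @ ys)"
    for xs ys
    by (induction xs arbitrary: ys) (simp_all del: list_encode.simps)
  note * = this[of "list_decode (g n)" for n, simplified list_decode_inverse]
  have "computable (\<lambda>n. foldl (\<lambda>r x. list_encode (x # list_decode r)) (g n)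
      (list_decode (list_encode (rev (list_decode (f n))))))"
    by (intro computable_intros assms)
  then show ?thesis by (simp add: * del: list_encode.simps)
qed

lemma computable_map [computable_intros]:
  assumes "computable (\<lambda>p. h (fst (prod_decode p)) (snd (prod_decode p)))" "computable f"
  shows "computable (\<lambda>n. list_encode (map (\<lambda>x. h n x) (list_decode (f n))))"
proof -
  have *: "foldl (\<lambda>r x. list_encode (h n x # list_decode r)) (list_encode ys) xs
      = list_encode (rev (map (\<lambda>x. h n x) xs) @ ys)" for n xs ys
    by (induction xs arbitrary: ys) (simp_all del: list_encode.simps)
  have "computable (\<lambda>n. list_encode (rev (list_decode
      (foldl (\<lambda>r x. list_encode (h n x # list_decode r)) (list_encode []) (list_decode (f n))))))"
    by (intro computable_intros assms computable_comp[OF assms(1), of "\<lambda>p. prod_encode (u p, v p)"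
       for u v, simplified])
  then show ?thesis unfolding * by simp
qed

lemma computable_concat_map [computable_intros]:
  assumes "computable (\<lambda>p. h (fst (prod_decode p)) (snd (prod_decode p)))" "computable f"
  shows "computable (\<lambda>n. list_encode (concat (map (\<lambda>x. list_decode (h n x)) (list_decode (f n)))))"
proof -
  have *: "foldl (\<lambda>r x. list_encode (list_decode r @ list_decode (h n x))) (list_encode ys) xs
      = list_encode (ys @ concat (map (\<lambda>x. list_decode (h n x)) xs))" for n xs ys
    by (induction xs arbitrary: ys) (simp_all del: list_encode.simps)
  have "computable (\<lambda>n. foldl (\<lambda>r x. list_encode (list_decode r @ list_decode (h n x)))
       (list_encode []) (list_decode (f n)))"
    by (intro computable_intros assms computable_comp[OF assms(1), of "\<lambda>p. prod_encode (u p, v p)"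
       for u v, simplified])
  then show ?thesis unfolding * by simp
qed

section \<open>Dual groups and cosets\<close>

lemma carrier_dual_group [simp]: "carrier (dual_group G) = carrier G"
  and one_dual_group [simp]: "\<one>\<^bsub>dual_group G\<^esub> = \<one>\<^bsub>G\<^esub>"
  and mult_dual_group [simp]: "x \<otimes>\<^bsub>dual_group G\<^esub> y = y \<otimes>\<^bsub>G\<^esub> x"
  by (simp_all add: dual_group_def)

lemma dual_dual_group [simp]: "dual_group (dual_group G) = G"
  by (simp add: dual_group_def)

lemma inv_dual_group [simp]: "inv\<^bsub>dual_group G\<^esub> x = inv\<^bsub>G\<^esub> x"
  unfolding m_inv_def by simp (metis)

lemma (in group) group_dual_group [simp]: "group (dual_group G)"
  by (rule groupI) (auto simp: m_assoc intro: r_inv)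

lemma r_coset_dual_group [simp]: "M #>\<^bsub>dual_group G\<^esub> x = x <#\<^bsub>G\<^esub> M"
  by (simp add: r_coset_def l_coset_def)

lemma generate_dual_group [simp]: "generate (dual_group G) A = generate G A"
proof -
  \<comment> \<open>Proved for every \<open>H\<close>, because the reverse inclusion is the instance
    \<open>H = dual_group G\<close>.\<close>
  have sub: "generate (dual_group H) A \<subseteq> generate H A" for H :: "('a, 'b) monoid_scheme"
  proof
    fix x assume "x \<in> generate (dual_group H) A"
    then show "x \<in> generate H A"
      by induction (auto intro: generate.intros)
  qed
  from sub[of G] sub[of "dual_group G"] show ?thesis by auto
qed

lemma (in group) subgroup_dual_group [simp]: "subgroup M (dual_group G) \<longleftrightarrow> subgroup M G"
  by (auto simp: subgroup_def)

lemma fin_gen_dual_group [simp]: "fin_gen (dual_group G) M \<longleftrightarrow> fin_gen G M"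
  by (simp add: fin_gen_def)

lemma gen_list_dual_group [simp]: "gen_list (dual_group G) X \<longleftrightarrow> gen_list G X"
  by (simp add: gen_list_def)

lemma tall_subgroups_dual_group [simp]: "tall_subgroups G (dual_group H) = tall_subgroups G H"
  by (simp add: tall_subgroups_def)

lemma (in group) gen_list_hom_image:
  assumes "group G'" "\<phi> \<in> hom G G'" "\<phi> ` carrier G = carrier G'" "gen_list G X"
  shows "gen_list G' (map \<phi> X)"
proof -
  interpret group_hom G G' \<phi>
    using assms by (simp add: group_hom_def group_hom_axioms_def is_group)
  show ?thesis
    using assms generate_img[of "set X"] by (auto simp: gen_list_def)
qed

lemma (in group_hom) fin_gen_hom_image: "fin_gen G L \<Longrightarrow> fin_gen H (h ` L)"
  unfolding fin_gen_def using generate_img by (metis finite_imageI hom_closed image_subset_iff subset_iff)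

text \<open>The factor \<open>c\<close> is included because the inversion step is a homomorphism
  only up to a fixed right factor. Right translation changes the representative of a right coset but
  not its subgroup.\<close>

lemma (in group_hom) image_r_coset:
  assumes "L \<subseteq> carrier G" "x \<in> carrier G" "c \<in> carrier H"
  shows "(\<lambda>z. h z \<otimes>\<^bsub>H\<^esub> c) ` (L #> x) = h ` L #>\<^bsub>H\<^esub> (h x \<otimes>\<^bsub>H\<^esub> c)"
  using assms unfolding r_coset_def by (force simp: H.m_assoc subset_iff)

lemma (in group) conjugation_hom: "y \<in> carrier G \<Longrightarrow> (\<lambda>h. inv y \<otimes> h \<otimes> y) \<in> hom G G"
proof -
  assume y: "y \<in> carrier G"
  have "y \<otimes> (inv y \<otimes> z) = z" if "z \<in> carrier G" for z
    using that y by (simp add: m_assoc[symmetric])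
  then show ?thesis using y by (auto simp: hom_def m_assoc)
qed

text \<open>Serves the first index, where no projection into a dual group has yet turned the right
  coset \<open>L x\<close> into a left coset.\<close>

lemma (in group) r_coset_eq_l_coset:
  assumes "L \<subseteq> carrier G" "y \<in> carrier G"
  shows "L #> y = y <# ((\<lambda>h. inv y \<otimes> h \<otimes> y) ` L)"
proof -
  have "y \<otimes> (inv y \<otimes> h \<otimes> y) = h \<otimes> y" if "h \<in> L" for h
    using that assms by (simp add: m_assoc[symmetric] subset_iff)
  then show ?thesis by (simp add: r_coset_def l_coset_def)
qed

text \<open>Both cosets can be rewritten with the common representative \<open>z\<close>, and
  multiplication by \<open>z\<close> is injective. Hence one element and the intersection of the
  subgroups determine the intersection of the cosets.\<close>

lemma (in group) r_coset_Int:
  assumes "subgroup W G" "subgroup K G" "x \<in> carrier G" "y \<in> carrier G"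
    and "z \<in> (W #> x) \<inter> (K #> y)"
  shows "(W #> x) \<inter> (K #> y) = (W \<inter> K) #> z"
proof -
  have z: "z \<in> carrier G"
    using assms subgroup.subset r_coset_subset_G by blast
  have "W #> x = W #> z" "K #> y = K #> z"
    using assms repr_independence by auto
  moreover have "(W \<inter> K) #> z = (W #> z) \<inter> (K #> z)"
    using right_cancel[OF z] assms(1,2)[THEN subgroup.mem_carrier] unfolding r_coset_def by auto
  ultimately show ?thesis by simp
qed

section \<open>Group words\<close>

lemma gword_over_simps [simp]:
  "gword_over X []"
  "gword_over X (p # w) \<longleftrightarrow> fst p < length X \<and> gword_over X w"
  "gword_over X (w @ w') \<longleftrightarrow> gword_over X w \<and> gword_over X w'"
  by (auto simp: gword_over_def)

lemma gword_over_rev [simp]: "gword_over X (rev w) \<longleftrightarrow> gword_over X w"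
  by (auto simp: gword_over_def)

definition gword_inv :: "gword \<Rightarrow> gword" where
  "gword_inv w = rev (map (\<lambda>(n, b). (n, \<not> b)) w)"

context group
begin

lemma gword_val_Nil [simp]: "gword_val G X [] = \<one>"
  by (simp add: gword_val_def)

lemma gword_val_Cons:
  "gword_val G X ((n, b) # w) = (if b then inv (X ! n) else X ! n) \<otimes> gword_val G X w"
  by (simp add: gword_val_def)

lemma gword_val_closed [simp]:
  assumes "set X \<subseteq> carrier G" "gword_over X w"
  shows "gword_val G X w \<in> carrier G"
  using assms(2)
proof (induction w)
  case (Cons p w)
  moreover have "X ! fst p \<in> carrier G" if "fst p < length X"
    using that assms(1) nth_mem by blast
  ultimately show ?case by (cases p) (auto simp: gword_val_Cons)
qed simp

lemma gword_val_append:
  assumes "set X \<subseteq> carrier G" "gword_over X w" "gword_over X w'"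
  shows "gword_val G X (w @ w') = gword_val G X w \<otimes> gword_val G X w'"
  using assms(2)
proof (induction w)
  case (Cons p w)
  moreover have "X ! fst p \<in> carrier G" if "fst p < length X"
    using that assms(1) nth_mem by blast
  ultimately show ?case using assms(1,3) by (cases p) (auto simp: gword_val_Cons m_assoc)
qed (use assms in simp)

lemma gword_over_inv [simp]: "gword_over X (gword_inv w) \<longleftrightarrow> gword_over X w"
  by (force simp: gword_over_def gword_inv_def)

lemma gword_val_inv:
  assumes "set X \<subseteq> carrier G" "gword_over X w"
  shows "gword_val G X (gword_inv w) = inv (gword_val G X w)"
  using assms(2)
proof (induction w)
  case (Cons p w)
  obtain n b where p: "p = (n, b)" by (cases p)
  have X: "X ! n \<in> carrier G" using Cons.prems assms(1) nth_mem p by auto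
  have "gword_inv (p # w) = gword_inv w @ [(n, \<not> b)]"
    by (simp add: gword_inv_def p)
  then show ?case
    using Cons X assms(1) p by (simp add: gword_val_append gword_val_Cons inv_mult_group)
qed (simp add: gword_inv_def)

lemma gword_val_surj:
  assumes "gen_list G X" "g \<in> carrier G"
  shows "\<exists>w. gword_over X w \<and> gword_val G X w = g"
proof -
  have X: "set X \<subseteq> carrier G" and "g \<in> generate G (set X)"
    using assms by (auto simp: gen_list_def)
  from this(2) show ?thesis
  proof induction
    case one
    show ?case by (rule exI[of _ "[]"]) simp
  next
    case (incl h)
    then obtain n where "n < length X" "X ! n = h" by (metis in_set_conv_nth)
    then show ?case using X incl by (intro exI[of _ "[(n, False)]"]) (auto simp: gword_val_Cons)
  next
    case (inv h)
    then obtain n where "n < length X" "X ! n = h" by (metis in_set_conv_nth)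
    then show ?case using X inv by (intro exI[of _ "[(n, True)]"]) (auto simp: gword_val_Cons)
  next
    case (eng h1 h2)
    then obtain w1 w2 where "gword_over X w1" "gword_val G X w1 = h1"
      "gword_over X w2" "gword_val G X w2 = h2" by blast
    then show ?case using X by (intro exI[of _ "w1 @ w2"]) (auto simp: gword_val_append)
  qed
qed

text \<open>The dual group multiplies in the opposite order but has the same inverses, so the
  letters are reversed while their signs stay.\<close>

lemma gword_val_dual_group:
  assumes "set X \<subseteq> carrier G" "gword_over X w"
  shows "gword_val (dual_group G) X w = gword_val G X (rev w)"
  using assms(2)
proof (induction w)
  case (Cons p w)
  interpret dual: group "dual_group G" by (rule group_dual_group)
  obtain n b where p: "p = (n, b)" by (cases p)
  have "X ! n \<in> carrier G" using Cons.prems assms(1) nth_mem p by auto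
  then show ?case
    using Cons assms(1) p by (auto simp: dual.gword_val_Cons gword_val_append gword_val_Cons)
qed (simp add: gword_val_def)

lemma gword_vals_subset:
  assumes "set X \<subseteq> carrier G" "\<forall>w\<in>set ws. gword_over X w"
  shows "gword_val G X ` set ws \<subseteq> carrier G"
  using assms gword_val_closed by auto

lemma subgroup_gword_span:
  assumes "set X \<subseteq> carrier G" "\<forall>w\<in>set ws. gword_over X w"
  shows "subgroup (gword_span G X ws) G"
  unfolding gword_span_def by (intro generate_is_subgroup gword_vals_subset assms)

lemma fin_gen_gword_span:
  assumes "set X \<subseteq> carrier G" "\<forall>w\<in>set ws. gword_over X w"
  shows "fin_gen G (gword_span G X ws)"
  unfolding gword_span_def fin_gen_def using gword_vals_subset[OF assms] by blast

lemma gword_span_rev: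
  assumes "set X \<subseteq> carrier G" "\<forall>w\<in>set ws. gword_over X w"
  shows "gword_span (dual_group G) X (map rev ws) = gword_span G X ws"
proof -
  have "gword_val (dual_group G) X ` rev ` set ws = gword_val G X ` set ws"
    unfolding image_image using assms by (intro image_cong) (auto simp: gword_val_dual_group)
  then show ?thesis by (simp add: gword_span_def)
qed

end

section \<open>Codes of words and translation between generating lists\<close>

definition letter_code :: "nat \<times> bool \<Rightarrow> nat" where
  "letter_code p = prod_encode (fst p, of_bool (snd p))"

lemma gword_code_alt: "gword_code w = list_encode (map letter_code w)"
  by (simp add: gword_code_def letter_code_def[abs_def] case_prod_beta')

lemma list_decode_gword_code [simp]: "list_decode (gword_code w) = map letter_code w"
  by (simp add: gword_code_alt)

lemma list_decode_gwords_code [simp]: "list_decode (gwords_code ws) = map gword_code ws"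
  by (simp add: gwords_code_def)

lemma inj_letter_code: "inj letter_code"
  by (rule injI) (auto simp: letter_code_def prod_eq_iff of_bool_def split: if_splits)

lemma gword_code_append:
  "gword_code (v @ w) = list_encode (list_decode (gword_code v) @ list_decode (gword_code w))"
  by (simp add: gword_code_alt)

lemma gwords_code_append:
  "gwords_code (v @ w) = list_encode (list_decode (gwords_code v) @ list_decode (gwords_code w))"
  by (simp add: gwords_code_def)

text \<open>Images of the letters are written over \<open>X'\<close> once and for all, and
  substituting them letter by letter evaluates \<open>\<phi>\<close> on words. For the identity this
  is a change of generating list. \<open>\<tau>\<close> acts on words, \<open>T\<close> on their
  codes and \<open>Ts\<close> on codes of lists of words.\<close>

lemma gword_translation:
  assumes "group G" "group G'" "\<phi> \<in> hom G G'" "set X \<subseteq> carrier G" "gen_list G' X'"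
  obtains \<tau> T Ts where
    "\<And>w. gword_over X w \<Longrightarrow> gword_over X' (\<tau> w)"
    "\<And>w. gword_over X w \<Longrightarrow> gword_val G' X' (\<tau> w) = \<phi> (gword_val G X w)"
    "\<And>ws. \<forall>w\<in>set ws. gword_over X w \<Longrightarrow>
       gword_val G' X' ` set (map \<tau> ws) = \<phi> ` gword_val G X ` set ws"
    "\<And>ws. \<forall>w\<in>set ws. gword_over X w \<Longrightarrow>
       gword_span G' X' (map \<tau> ws) = \<phi> ` gword_span G X ws"
    "computable T" "\<And>w. gword_over X w \<Longrightarrow> T (gword_code w) = gword_code (\<tau> w)"
    "computable Ts" "\<And>ws. \<forall>w\<in>set ws. gword_over X w \<Longrightarrow>
       Ts (gwords_code ws) = gwords_code (map \<tau> ws)"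
proof -
  interpret group_hom G G' \<phi>
    using assms by (simp add: group_hom_def group_hom_axioms_def)
  have X': "set X' \<subseteq> carrier G'" using assms(5) by (simp add: gen_list_def)
  have X: "X ! n \<in> carrier G" if "n < length X" for n
    using that assms(4) nth_mem by blast
  \<comment> \<open>A word is chosen for each signed letter, so inverse letters need no separate
    treatment.\<close>
  define t where
    "t = (\<lambda>p. SOME w. gword_over X' w \<and> gword_val G' X' w = \<phi> (gword_val G X [p]))"
  have t: "gword_over X' (t p)" "gword_val G' X' (t p) = \<phi> (gword_val G X [p])"
    if "fst p < length X" for p
  proof -
    have "\<phi> (gword_val G X [p]) \<in> carrier G'"
      using that assms(4) by (intro hom_closed G.gword_val_closed) auto
    from H.gword_val_surj[OF assms(5) this]
    have "gword_over X' (t p) \<and> gword_val G' X' (t p) = \<phi> (gword_val G X [p])"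
      unfolding t_def by (rule someI_ex)
    then show "gword_over X' (t p)" "gword_val G' X' (t p) = \<phi> (gword_val G X [p])" by auto
  qed
  define \<tau> where "\<tau> = (\<lambda>w. concat (map t w))"
  have \<tau>: "gword_over X' (\<tau> w) \<and> gword_val G' X' (\<tau> w) = \<phi> (gword_val G X w)"
    if "gword_over X w" for w
    using that
  proof (induction w)
    case (Cons p w)
    have "gword_val G X ([p] @ w) = gword_val G X [p] \<otimes>\<^bsub>G\<^esub> gword_val G X w"
      using Cons.prems assms(4) by (intro G.gword_val_append) auto
    moreover have "gword_val G X [p] \<in> carrier G" "gword_val G X w \<in> carrier G"
      using Cons.prems assms(4) by auto
    moreover have "\<tau> (p # w) = t p @ \<tau> w" by (simp add: \<tau>_def)
    ultimately show ?case using Cons X' t[of p] by (simp add: H.gword_val_append)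
  qed (simp add: \<tau>_def)
  \<comment> \<open>Only finitely many letter codes occur in words over \<open>X\<close>, so the
    chosen substitution is a finite table.\<close>
  define A where "A = letter_code ` ({..<length X} \<times> UNIV)"
  have "finite A" by (simp add: A_def)
  then obtain T0 where T0: "computable T0"
    "\<And>n. n \<in> A \<Longrightarrow> T0 n = gword_code (t (inv_into UNIV letter_code n))"
    by (rule computable_finite_table[where h = "\<lambda>n. gword_code (t (inv_into UNIV letter_code n))"]) blast
  have T0': "T0 (letter_code p) = gword_code (t p)" if "fst p < length X" for p
    using that T0(2)[of "letter_code p"] inj_letter_code
    by (cases p) (auto simp: A_def)
  define T where "T = (\<lambda>n. list_encode (concat (map (\<lambda>x. list_decode (T0 x)) (list_decode n))))"
  have T: "T (gword_code w) = gword_code (\<tau> w)" if "gword_over X w" for w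
  proof -
    have "map (\<lambda>p. list_decode (T0 (letter_code p))) w = map (\<lambda>p. map letter_code (t p)) w"
      using that by (intro map_cong) (auto simp: T0' gword_over_def)
    then show ?thesis
      by (simp add: T_def \<tau>_def gword_code_alt comp_def map_concat cong: map_cong)
  qed
  have cT: "computable T"
    unfolding T_def by (intro computable_intros computable_comp[OF T0(1)])
  define Ts where "Ts = (\<lambda>n. list_encode (map (\<lambda>x. T x) (list_decode n)))"
  have cTs: "computable Ts"
    unfolding Ts_def by (intro computable_intros computable_comp[OF cT])
  have Ts: "Ts (gwords_code ws) = gwords_code (map \<tau> ws)" if "\<forall>w\<in>set ws. gword_over X w" for ws
    using that by (simp add: Ts_def gwords_code_def comp_def T cong: map_cong)
  have im: "gword_val G' X' ` set (map \<tau> ws) = \<phi> ` gword_val G X ` set ws"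
    if "\<forall>w\<in>set ws. gword_over X w" for ws
    using that \<tau> by (auto simp: image_image intro!: image_cong)
  have sp: "gword_span G' X' (map \<tau> ws) = \<phi> ` gword_span G X ws"
    if "\<forall>w\<in>set ws. gword_over X w" for ws
    unfolding gword_span_def im[OF that]
    using that assms(4) by (intro generate_img G.gword_vals_subset)
  show ?thesis
    by (rule that[of \<tau> T Ts]) (use \<tau> T Ts cT cTs im sp in auto)
qed

section \<open>Computable maps on right cosets\<close>

definition right_coset_output ::
  "('a, 'b) monoid_scheme \<Rightarrow> 'a list \<Rightarrow> 'a set \<Rightarrow> nat option \<Rightarrow> bool" where
  "right_coset_output G X Z r \<longleftrightarrow>
     (if Z = {} then r = Some 0
      else \<exists>ws y. r = Some (Suc (prod_encode (gwords_code ws, gword_code y))) \<and>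
             (\<forall>w\<in>set ws. gword_over X w) \<and> gword_over X y \<and>
             Z = gword_span G X ws #>\<^bsub>G\<^esub> gword_val G X y)"

lemma right_coset_outputI:
  assumes "r = Some (Suc (prod_encode (gwords_code ws, gword_code y)))" "Z \<noteq> {}"
    and "\<forall>w\<in>set ws. gword_over X w" "gword_over X y"
    and "Z = gword_span G X ws #>\<^bsub>G\<^esub> gword_val G X y"
  shows "right_coset_output G X Z r"
  unfolding right_coset_output_def using assms by auto

text \<open>The generating lists are parameters, in contrast to
  \<open>left_coset_computable\<close>, so that consecutive steps can be composed through one chosen
  intermediate list.\<close>

definition right_coset_computable ::
  "('a, 'b) monoid_scheme \<Rightarrow> 'a list \<Rightarrow> ('c, 'd) monoid_scheme \<Rightarrow> 'c list \<Rightarrow>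
   ('a set \<Rightarrow> 'c set) \<Rightarrow> bool" where
  "right_coset_computable G X G' X' F \<longleftrightarrow>
     (\<exists>f. partial_recursive f \<and>
        (\<forall>ws x. (\<forall>w\<in>set ws. gword_over X w) \<and> gword_over X x \<longrightarrow>
           right_coset_output G' X' (F (gword_span G X ws #>\<^bsub>G\<^esub> gword_val G X x))
             (f (prod_encode (gwords_code ws, gword_code x)))))"

lemma right_coset_computableI:
  assumes "partial_recursive f"
    and "\<And>ws x. \<lbrakk>\<forall>w\<in>set ws. gword_over X w; gword_over X x\<rbrakk> \<Longrightarrow>
      right_coset_output G' X' (F (gword_span G X ws #>\<^bsub>G\<^esub> gword_val G X x))
        (f (prod_encode (gwords_code ws, gword_code x)))"
  shows "right_coset_computable G X G' X' F"
  using assms unfolding right_coset_computable_def by blast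

text \<open>A nonzero output is the successor of an input code, so a predecessor connects the two
  algorithms. Output 0 codes no coset and is passed on without running the second algorithm, which
  could diverge on it.\<close>

lemma right_coset_computable_comp:
  assumes "right_coset_computable G X G' X' F" "right_coset_computable G' X' G'' X'' F'"
    and "F' {} = {}"
  shows "right_coset_computable G X G'' X'' (\<lambda>Z. F' (F Z))"
proof -
  obtain f where f: "partial_recursive f"
    "\<And>ws x. \<lbrakk>\<forall>w\<in>set ws. gword_over X w; gword_over X x\<rbrakk> \<Longrightarrow>
      right_coset_output G' X' (F (gword_span G X ws #>\<^bsub>G\<^esub> gword_val G X x))
        (f (prod_encode (gwords_code ws, gword_code x)))"
    using assms(1) unfolding right_coset_computable_def by blast
  obtain f' where f': "partial_recursive f'"
    "\<And>ws x. \<lbrakk>\<forall>w\<in>set ws. gword_over X' w; gword_over X' x\<rbrakk> \<Longrightarrow>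
      right_coset_output G'' X'' (F' (gword_span G' X' ws #>\<^bsub>G'\<^esub> gword_val G' X' x))
        (f' (prod_encode (gwords_code ws, gword_code x)))"
    using assms(2) unfolding right_coset_computable_def by blast
  have "partial_recursive (\<lambda>r. if r = 0 then Some 0 else Option.bind (Some (r - 1)) f')"
    using f'(1) computable_pred[OF computable_id]
    by (intro partial_recursive_if_zero partial_recursive.comp computable_id)
      (simp_all add: computable_def)
  then have rec: "partial_recursive (\<lambda>n. Option.bind (f n)
      (\<lambda>r. if r = 0 then Some 0 else Option.bind (Some (r - 1)) f'))"
    by (rule partial_recursive.comp) (rule f(1))
  show ?thesis
  proof (rule right_coset_computableI, rule rec)
    fix ws x assume ws: "\<forall>w\<in>set ws. gword_over X w" "gword_over X x"
    define Z where "Z = F (gword_span G X ws #>\<^bsub>G\<^esub> gword_val G X x)"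
    define r where "r = f (prod_encode (gwords_code ws, gword_code x))"
    have Z: "right_coset_output G' X' Z r"
      using f(2)[OF ws] by (simp add: Z_def r_def)
    have "right_coset_output G'' X'' (F' Z)
      (Option.bind r (\<lambda>r. if r = 0 then Some 0 else Option.bind (Some (r - 1)) f'))"
    proof (cases "Z = {}")
      case True
      then show ?thesis using Z assms(3) by (simp add: right_coset_output_def)
    next
      case False
      then obtain ws' y where y: "r = Some (Suc (prod_encode (gwords_code ws', gword_code y)))"
        "\<forall>w\<in>set ws'. gword_over X' w" "gword_over X' y"
        "Z = gword_span G' X' ws' #>\<^bsub>G'\<^esub> gword_val G' X' y"
        using Z by (auto simp: right_coset_output_def)
      from f'(2)[OF y(2,3)] show ?thesis by (simp add: y(1,4))
    qed
    then show "right_coset_output G'' X'' (F' (F (gword_span G X ws #>\<^bsub>G\<^esub> gword_val G X x)))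
      (Option.bind (f (prod_encode (gwords_code ws, gword_code x)))
         (\<lambda>r. if r = 0 then Some 0 else Option.bind (Some (r - 1)) f'))"
      by (simp only: Z_def r_def)
  qed
qed

lemma (in group) right_coset_computable_cong:
  assumes "right_coset_computable G X G' X' F" "set X \<subseteq> carrier G"
    and "\<And>Z. Z \<subseteq> carrier G \<Longrightarrow> F Z = F' Z"
  shows "right_coset_computable G X G' X' F'"
proof -
  have "F (gword_span G X ws #> gword_val G X x) = F' (gword_span G X ws #> gword_val G X x)"
    if "(\<forall>w\<in>set ws. gword_over X w) \<and> gword_over X x" for ws x
    using that assms(2) subgroup.subset[OF subgroup_gword_span, of X ws]
    by (intro assms(3) r_coset_subset_G) auto
  with assms(1) show ?thesis
    unfolding right_coset_computable_def by (metis (no_types, lifting))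
qed

lemma right_coset_computable_empty: "right_coset_computable G X G' X' (\<lambda>Z. {})"
  unfolding right_coset_computable_def
  by (intro exI[of _ "\<lambda>n. Some 0"]) (simp add: partial_recursive.zero right_coset_output_def)

lemma right_coset_computable_hom:
  assumes "group G" "group G'" "\<phi> \<in> hom G G'" "set X \<subseteq> carrier G" "gen_list G' X'" "c \<in> carrier G'"
  shows "right_coset_computable G X G' X' (\<lambda>Z. (\<lambda>z. \<phi> z \<otimes>\<^bsub>G'\<^esub> c) ` Z)"
proof -
  interpret group_hom G G' \<phi>
    using assms by (simp add: group_hom_def group_hom_axioms_def)
  have X': "set X' \<subseteq> carrier G'" using assms(5) by (simp add: gen_list_def)
  obtain \<tau> T Ts where \<tau>: "\<And>w. gword_over X w \<Longrightarrow> gword_over X' (\<tau> w)"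
    "\<And>w. gword_over X w \<Longrightarrow> gword_val G' X' (\<tau> w) = \<phi> (gword_val G X w)"
    "\<And>ws. \<forall>w\<in>set ws. gword_over X w \<Longrightarrow> gword_span G' X' (map \<tau> ws) = \<phi> ` gword_span G X ws"
    and T: "computable T" "\<And>w. gword_over X w \<Longrightarrow> T (gword_code w) = gword_code (\<tau> w)"
    "computable Ts" "\<And>ws. \<forall>w\<in>set ws. gword_over X w \<Longrightarrow>
       Ts (gwords_code ws) = gwords_code (map \<tau> ws)"
    using gword_translation[OF assms(1-5)] by metis
  obtain d where d: "gword_over X' d" "gword_val G' X' d = c"
    using H.gword_val_surj[OF assms(5,6)] by blast
  define f where "f = (\<lambda>n. Suc (prod_encode (Ts (fst (prod_decode n)),
     list_encode (list_decode (T (snd (prod_decode n))) @ list_decode (gword_code d)))))"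
  have "computable f"
    unfolding f_def by (intro computable_intros computable_comp[OF T(1)] computable_comp[OF T(3)])
  then have rec: "partial_recursive (\<lambda>n. Some (f n))" by (simp only: computable_def)
  show ?thesis
  proof (rule right_coset_computableI, rule rec)
    fix ws x assume ws: "\<forall>w\<in>set ws. gword_over X w" and x: "gword_over X x"
    have L: "subgroup (gword_span G X ws) G" by (rule G.subgroup_gword_span[OF assms(4) ws])
    have xc: "gword_val G X x \<in> carrier G" using assms(4) x by simp
    have f: "f (prod_encode (gwords_code ws, gword_code x)) =
      Suc (prod_encode (gwords_code (map \<tau> ws), gword_code (\<tau> x @ d)))"
      unfolding f_def gword_code_append using T ws x by simp
    show "right_coset_output G' X' ((\<lambda>z. \<phi> z \<otimes>\<^bsub>G'\<^esub> c) ` (gword_span G X ws #>\<^bsub>G\<^esub> gword_val G X x))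
      (Some (f (prod_encode (gwords_code ws, gword_code x))))"
    proof (rule right_coset_outputI)
      show "(\<lambda>z. \<phi> z \<otimes>\<^bsub>G'\<^esub> c) ` (gword_span G X ws #>\<^bsub>G\<^esub> gword_val G X x) \<noteq> {}"
        using G.rcos_self[OF xc L] by blast
      show "(\<lambda>z. \<phi> z \<otimes>\<^bsub>G'\<^esub> c) ` (gword_span G X ws #>\<^bsub>G\<^esub> gword_val G X x) =
        gword_span G' X' (map \<tau> ws) #>\<^bsub>G'\<^esub> gword_val G' X' (\<tau> x @ d)"
        unfolding image_r_coset[OF subgroup.subset[OF L] xc assms(6)]
        using \<tau> ws x d X' by (simp add: H.gword_val_append)
    qed (use \<tau>(1) ws x d(1) f in auto)
  qed
qed

lemma (in group) right_coset_computable_dual_group: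
  assumes "set X \<subseteq> carrier G" "gen_list G X'"
  shows "right_coset_computable G X (dual_group G) X' (\<lambda>Z. Z)"
proof -
  have X': "set X' \<subseteq> carrier G" using assms(2) by (simp add: gen_list_def)
  have "(\<lambda>z. z) \<in> hom G G" by (simp add: hom_def)
  then obtain \<tau> T where \<tau>: "\<And>w. gword_over X w \<Longrightarrow> gword_over X' (\<tau> w)"
    "\<And>w. gword_over X w \<Longrightarrow> gword_val G X' (\<tau> w) = gword_val G X w"
    and T: "computable T" "\<And>w. gword_over X w \<Longrightarrow> T (gword_code w) = gword_code (\<tau> w)"
    using gword_translation[OF is_group is_group _ assms] by metis
  (* Lx = x (x^-1 L x), and words are reversed on passing to the dual group. *)
  define conj where "conj = (\<lambda>x w. rev ((gword_inv (\<tau> x) @ \<tau> w) @ \<tau> x))"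
  \<comment> \<open>The operation \<open>gword_inv\<close> on codes: every sign bit is flipped and
    the list is reversed.\<close>
  define J where "J = (\<lambda>n. list_encode (rev (list_decode (list_encode (map (\<lambda>k.
     prod_encode (fst (prod_decode k), if snd (prod_decode k) = 0 then 1 else 0)) (list_decode n))))))"
  have cJ: "computable J" unfolding J_def by (intro computable_intros)
  have J: "J (gword_code w) = gword_code (gword_inv w)" for w
  proof -
    have "(\<lambda>k. prod_encode (fst (prod_decode k), if snd (prod_decode k) = 0 then 1 else 0)) \<circ> letter_code
      = letter_code \<circ> (\<lambda>(n, b). (n, \<not> b))"
      by (auto simp: fun_eq_iff letter_code_def)
    then show ?thesis by (simp add: J_def gword_code_alt gword_inv_def rev_map)
  qed
  \<comment> \<open>The inner term is \<open>conj\<close> carried out on codes, applied to every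
    generator; the last component is the reversed word for the representative.\<close>
  define f where "f = (\<lambda>n. Suc (prod_encode (list_encode (map (\<lambda>k.
      list_encode (rev (list_decode (list_encode (list_decode (list_encode
         (list_decode (J (T (snd (prod_decode n)))) @ list_decode (T k)))
           @ list_decode (T (snd (prod_decode n)))))))) (list_decode (fst (prod_decode n)))),
     list_encode (rev (list_decode (T (snd (prod_decode n))))))))"
  have "computable f"
    unfolding f_def by (intro computable_intros computable_comp[OF T(1)] computable_comp[OF cJ])
  then have rec: "partial_recursive (\<lambda>n. Some (f n))" by (simp only: computable_def)
  show ?thesis
  proof (rule right_coset_computableI, rule rec)
    fix ws x assume ws: "\<forall>w\<in>set ws. gword_over X w" and x: "gword_over X x"
    define y where "y = gword_val G X x"
    have L: "subgroup (gword_span G X ws) G" by (rule subgroup_gword_span[OF assms(1) ws])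
    have yc: "y \<in> carrier G" using assms(1) x by (simp add: y_def)
    have f: "f (prod_encode (gwords_code ws, gword_code x)) =
      Suc (prod_encode (gwords_code (map (conj x) ws), gword_code (rev (\<tau> x))))"
      unfolding f_def using T ws x by (simp add: J[unfolded gword_code_alt] conj_def gwords_code_def gword_code_alt rev_map comp_def cong: map_cong)
    have over: "\<forall>w\<in>set (map (conj x) ws). gword_over X' w"
      using ws x \<tau>(1) by (auto simp: conj_def)
    define \<psi> where "\<psi> = (\<lambda>h. inv y \<otimes> h \<otimes> y)"
    interpret \<psi>: group_hom G G \<psi>
      using conjugation_hom[OF yc] by (simp add: group_hom_def group_hom_axioms_def is_group \<psi>_def)
    have "gword_span (dual_group G) X' (map (conj x) ws) = generate G (\<psi> ` gword_val G X ` set ws)"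
      unfolding gword_span_def generate_dual_group set_map image_image
      using ws x \<tau> X' assms(1)
      by (intro arg_cong[where f = "generate G"] image_cong)
        (auto simp: gword_val_dual_group conj_def gword_val_append gword_val_inv \<psi>_def y_def m_assoc)
    also have "\<dots> = \<psi> ` gword_span G X ws"
      unfolding gword_span_def by (intro \<psi>.generate_img gword_vals_subset assms ws)
    finally have span: "gword_span (dual_group G) X' (map (conj x) ws) = \<psi> ` gword_span G X ws" .
    have val: "gword_val (dual_group G) X' (rev (\<tau> x)) = y"
      using x \<tau> X' by (simp add: gword_val_dual_group y_def)
    show "right_coset_output (dual_group G) X' (gword_span G X ws #> gword_val G X x)
      (Some (f (prod_encode (gwords_code ws, gword_code x))))"
    proof (rule right_coset_outputI)
      show "gword_span G X ws #> gword_val G X x \<noteq> {}"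
        using rcos_self[OF yc L] by (auto simp: y_def)
      show "gword_span G X ws #> gword_val G X x = gword_span (dual_group G) X' (map (conj x) ws)
        #>\<^bsub>dual_group G\<^esub> gword_val (dual_group G) X' (rev (\<tau> x))"
        using r_coset_eq_l_coset[OF subgroup.subset[OF L] yc] span val by (simp add: y_def \<psi>_def)
    qed (use over x \<tau>(1) f in auto)
  qed
qed

text \<open>Right cosets of the dual group already are left cosets of the group; only the output
  words have to be adapted, by reversing each of them.\<close>

lemma (in group) left_coset_computableI:
  assumes "\<And>X X'. gen_list K X \<Longrightarrow> gen_list G X' \<Longrightarrow> right_coset_computable K X (dual_group G) X' F"
  shows "left_coset_computable K G F"
proof -
  have "\<exists>f. partial_recursive f \<and>
           (\<forall>ws x. (\<forall>w\<in>set ws. gword_over X w) \<and> gword_over X x \<longrightarrow>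
              (let Z = F (gword_span K X ws #>\<^bsub>K\<^esub> gword_val K X x);
                   r = f (prod_encode (gwords_code ws, gword_code x))
               in if Z = {} then r = Some 0
                  else \<exists>ws' y. r = Some (Suc (prod_encode (gwords_code ws', gword_code y))) \<and>
                         (\<forall>w\<in>set ws'. gword_over X' w) \<and> gword_over X' y \<and>
                         Z = gword_val G X' y <# gword_span G X' ws'))"
    if X: "gen_list K X" and X': "gen_list G X'" for X X'
  proof -
    have X's: "set X' \<subseteq> carrier G" using X' by (simp add: gen_list_def)
    obtain f where f: "partial_recursive f"
      "\<And>ws x. \<lbrakk>\<forall>w\<in>set ws. gword_over X w; gword_over X x\<rbrakk> \<Longrightarrow>
        right_coset_output (dual_group G) X' (F (gword_span K X ws #>\<^bsub>K\<^esub> gword_val K X x))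
          (f (prod_encode (gwords_code ws, gword_code x)))"
      using assms[OF X X'] unfolding right_coset_computable_def by blast
    define h where "h = (\<lambda>r. if r = 0 then 0 else Suc (prod_encode (
      list_encode (map (\<lambda>k. list_encode (rev (list_decode k))) (list_decode (fst (prod_decode (r - 1))))),
      list_encode (rev (list_decode (snd (prod_decode (r - 1))))))))"
    have "computable h" unfolding h_def by (intro computable_intros)
    then have "partial_recursive (\<lambda>r. Some (h r))" by (simp only: computable_def)
    then have rec: "partial_recursive (\<lambda>n. Option.bind (f n) (\<lambda>r. Some (h r)))"
      by (rule partial_recursive.comp) (rule f(1))
    show ?thesis
    proof (intro exI conjI allI impI, rule rec)
      fix ws x assume ws: "(\<forall>w\<in>set ws. gword_over X w) \<and> gword_over X x"
      define Z where "Z = F (gword_span K X ws #>\<^bsub>K\<^esub> gword_val K X x)"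
      have Z: "right_coset_output (dual_group G) X' Z (f (prod_encode (gwords_code ws, gword_code x)))"
        using f(2)[of ws x] ws by (simp add: Z_def)
      show "let Z = F (gword_span K X ws #>\<^bsub>K\<^esub> gword_val K X x);
              r = Option.bind (f (prod_encode (gwords_code ws, gword_code x))) (\<lambda>r. Some (h r))
            in if Z = {} then r = Some 0
                  else \<exists>ws' y. r = Some (Suc (prod_encode (gwords_code ws', gword_code y))) \<and>
                         (\<forall>w\<in>set ws'. gword_over X' w) \<and> gword_over X' y \<and>
                         Z = gword_val G X' y <# gword_span G X' ws'"
      proof (cases "Z = {}")
        case True
        then show ?thesis using Z by (simp add: right_coset_output_def h_def flip: Z_def)
      next
        case False
        then obtain ws' y where y: "f (prod_encode (gwords_code ws, gword_code x)) =
             Some (Suc (prod_encode (gwords_code ws', gword_code y)))"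
          "\<forall>w\<in>set ws'. gword_over X' w" "gword_over X' y"
          "Z = gword_val (dual_group G) X' y <# gword_span (dual_group G) X' ws'"
          using Z by (auto simp: right_coset_output_def)
        have "h (Suc (prod_encode (gwords_code ws', gword_code y))) =
          Suc (prod_encode (gwords_code (map rev ws'), gword_code (rev y)))"
          by (simp add: h_def gwords_code_def gword_code_alt rev_map comp_def)
        moreover have "gword_val (dual_group G) X' y = gword_val G X' (rev y)"
          using X's y(3) by (rule gword_val_dual_group)
        moreover have "gword_span (dual_group G) X' ws' = gword_span G X' (map rev ws')"
          using gword_span_rev[OF X's, of "map rev ws'"] y(2) by (simp add: comp_def)
        ultimately show ?thesis
          using False y by (auto simp: Let_def simp flip: Z_def intro!: exI[of _ "map rev ws'"] exI[of _ "rev y"])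
      qed
    qed
  qed
  then show ?thesis unfolding left_coset_computable_def by blast
qed

section \<open>Generators and cosets of tall subgroups\<close>

lemma generate_Times:
  assumes "group G" "group H" "A \<subseteq> carrier G" "B \<subseteq> carrier H" "generate H B = carrier H"
  shows "generate (G \<times>\<times> H) ((\<lambda>g. (g, \<one>\<^bsub>H\<^esub>)) ` A \<union> (\<lambda>h. (\<one>\<^bsub>G\<^esub>, h)) ` B) = generate G A \<times> carrier H"
proof -
  interpret G: group G by fact
  interpret H: group H by fact
  interpret K: group "G \<times>\<times> H" by (intro DirProd_group assms)
  interpret l: group_hom G "G \<times>\<times> H" "\<lambda>g. (g, \<one>\<^bsub>H\<^esub>)"
    by unfold_locales (auto simp: hom_def)
  interpret r: group_hom H "G \<times>\<times> H" "\<lambda>h. (\<one>\<^bsub>G\<^esub>, h)"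
    by unfold_locales (auto simp: hom_def)
  let ?S = "(\<lambda>g. (g, \<one>\<^bsub>H\<^esub>)) ` A \<union> (\<lambda>h. (\<one>\<^bsub>G\<^esub>, h)) ` B"
  have S: "?S \<subseteq> carrier (G \<times>\<times> H)" using assms by auto
  have "?S \<subseteq> generate G A \<times> carrier H"
    using assms generate.incl[of _ A G] generate.one[of G A] by auto
  moreover have "subgroup (generate G A \<times> carrier H) (G \<times>\<times> H)"
    by (intro DirProd_subgroups assms G.generate_is_subgroup H.subgroup_self)
  ultimately have "generate (G \<times>\<times> H) ?S \<subseteq> generate G A \<times> carrier H"
    by (rule K.generate_subgroup_incl)
  moreover have "(g, h) \<in> generate (G \<times>\<times> H) ?S" if "g \<in> generate G A" "h \<in> carrier H" for g h
  proof -
    have "(g, \<one>\<^bsub>H\<^esub>) \<in> generate (G \<times>\<times> H) ?S"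
      using l.generate_img[OF assms(3)] that(1) K.mono_generate[of "(\<lambda>g. (g, \<one>\<^bsub>H\<^esub>)) ` A" ?S] by blast
    moreover have "(\<one>\<^bsub>G\<^esub>, h) \<in> generate (G \<times>\<times> H) ?S"
      using r.generate_img[OF assms(4)] that(2) assms(5) K.mono_generate[of "(\<lambda>h. (\<one>\<^bsub>G\<^esub>, h)) ` B" ?S]
      by blast
    ultimately have "(g, \<one>\<^bsub>H\<^esub>) \<otimes>\<^bsub>G \<times>\<times> H\<^esub> (\<one>\<^bsub>G\<^esub>, h) \<in> generate (G \<times>\<times> H) ?S"
      by (rule generate.eng)
    then show ?thesis using that G.generate_in_carrier[OF assms(3)] by simp
  qed
  ultimately show ?thesis by auto
qed

lemma r_coset_Times:
  assumes "group G" "group H" "x \<in> carrier G"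
  shows "(L #>\<^bsub>G\<^esub> x) \<times> carrier H = (L \<times> carrier H) #>\<^bsub>G \<times>\<times> H\<^esub> (x, \<one>\<^bsub>H\<^esub>)"
proof -
  interpret H: group H by fact
  show ?thesis by (auto simp: r_coset_def)
qed

(* eRHP and RCIP come with unrelated generating lists X1 and X2, so the input is translated into
   words over each of them. *)
lemma right_coset_computable_Int_tall:
  assumes G: "group G" and H: "group H" and G': "group G'" and \<phi>: "\<phi> \<in> hom (G \<times>\<times> H) G'"
    and X: "set X \<subseteq> carrier G" and X': "gen_list G' X'" and c: "c \<in> carrier G'"
    and W: "subgroup W (G \<times>\<times> H)" and g: "g \<in> carrier (G \<times>\<times> H)"
    and eRHP: "eRHP (G \<times>\<times> H) W (tall_subgroups G H)"
    and RCIP: "RCIP (G \<times>\<times> H) W (tall_subgroups G H)"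
  shows "right_coset_computable G X G' X'
    (\<lambda>Z. (\<lambda>z. \<phi> z \<otimes>\<^bsub>G'\<^esub> c) ` ((Z \<times> carrier H) \<inter> (W #>\<^bsub>G \<times>\<times> H\<^esub> g)))"
proof -
  interpret G: group G by fact
  interpret H: group H by fact
  interpret K: group "G \<times>\<times> H" by (intro DirProd_group G H)
  interpret \<phi>: group_hom "G \<times>\<times> H" G' \<phi>
    using G' \<phi> K.is_group by (simp add: group_hom_def group_hom_axioms_def)
  let ?K = "G \<times>\<times> H" and ?l = "\<lambda>g. (g, \<one>\<^bsub>H\<^esub>)"
  have X's: "set X' \<subseteq> carrier G'" using X' by (simp add: gen_list_def)
  have l: "?l \<in> hom G ?K" by (auto simp: hom_def)
  obtain X1 f1 where X1: "gen_list ?K X1" and f1: "partial_recursive f1"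
    "\<And>ws. \<lbrakk>\<forall>w\<in>set ws. gword_over X1 w; gword_span ?K X1 ws \<in> tall_subgroups G H\<rbrakk> \<Longrightarrow>
           \<exists>ws'. f1 (gwords_code ws) = Some (gwords_code ws') \<and>
                  (\<forall>w\<in>set ws'. gword_over X1 w) \<and>
                  gword_span ?K X1 ws' = W \<inter> gword_span ?K X1 ws"
    using eRHP unfolding eRHP_def by blast
  obtain X2 f2 where X2: "gen_list ?K X2" and f2: "partial_recursive f2"
    "\<And>ws x y. \<lbrakk>\<forall>w\<in>set ws. gword_over X2 w; gword_over X2 x; gword_over X2 y;
          gword_span ?K X2 ws \<in> tall_subgroups G H\<rbrakk> \<Longrightarrow>
           (let Z = (W #>\<^bsub>?K\<^esub> gword_val ?K X2 x) \<inter> (gword_span ?K X2 ws #>\<^bsub>?K\<^esub> gword_val ?K X2 y);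
                r = f2 (prod_encode (gwords_code ws, prod_encode (gword_code x, gword_code y)))
            in if Z = {} then r = Some 0
               else \<exists>z. r = Some (Suc (gword_code z)) \<and> gword_over X2 z \<and> gword_val ?K X2 z \<in> Z)"
    using RCIP unfolding RCIP_def by blast
  have X1s: "set X1 \<subseteq> carrier ?K" and X2s: "set X2 \<subseteq> carrier ?K"
    using X1 X2 unfolding gen_list_def by blast+
  \<comment> \<open>A finite generating list of \<open>H\<close> comes from the direct product by
    projection.\<close>
  have Y: "gen_list H (map snd X1)"
    by (rule K.gen_list_hom_image[OF H _ _ X1]) (auto simp: hom_def image_iff)
  \<comment> \<open>Words for generators of the second factor exist over either list of the product.
    They do not depend on the input and become constants of the algorithm.\<close>
  have lift: "\<exists>vs. (\<forall>v\<in>set vs. gword_over V v) \<and>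
      gword_val ?K V ` set vs = (\<lambda>h. (\<one>\<^bsub>G\<^esub>, h)) ` set (map snd X1)"
    if V: "gen_list ?K V" for V
  proof -
    have "\<exists>vs. (\<forall>v\<in>set vs. gword_over V v) \<and> gword_val ?K V ` set vs = (\<lambda>h. (\<one>\<^bsub>G\<^esub>, h)) ` set Y"
      if "set Y \<subseteq> carrier H" for Y
      using that
    proof (induction Y)
      case (Cons h Y)
      then obtain vs where "\<forall>v\<in>set vs. gword_over V v"
        "gword_val ?K V ` set vs = (\<lambda>h. (\<one>\<^bsub>G\<^esub>, h)) ` set Y" by auto
      moreover obtain v where "gword_over V v" "gword_val ?K V v = (\<one>\<^bsub>G\<^esub>, h)"
        using K.gword_val_surj[OF V, of "(\<one>\<^bsub>G\<^esub>, h)"] Cons.prems by auto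
      ultimately show ?case by (intro exI[of _ "v # vs"]) auto
    qed simp
    then show ?thesis using Y unfolding gen_list_def by blast
  qed
  obtain vs1 where vs1: "\<forall>v\<in>set vs1. gword_over X1 v"
    "gword_val ?K X1 ` set vs1 = (\<lambda>h. (\<one>\<^bsub>G\<^esub>, h)) ` set (map snd X1)"
    using lift[OF X1] by blast
  obtain vs2 where vs2: "\<forall>v\<in>set vs2. gword_over X2 v"
    "gword_val ?K X2 ` set vs2 = (\<lambda>h. (\<one>\<^bsub>G\<^esub>, h)) ` set (map snd X1)"
    using lift[OF X2] by blast
  obtain t1 T1 T1s where t1:
    "\<And>w. gword_over X w \<Longrightarrow> gword_over X1 (t1 w)"
    "\<And>w. gword_over X w \<Longrightarrow> gword_val ?K X1 (t1 w) = ?l (gword_val G X w)"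
    "\<And>ws. \<forall>w\<in>set ws. gword_over X w \<Longrightarrow>
       gword_val ?K X1 ` set (map t1 ws) = ?l ` gword_val G X ` set ws"
    "\<And>ws. \<forall>w\<in>set ws. gword_over X w \<Longrightarrow>
       gword_span ?K X1 (map t1 ws) = ?l ` gword_span G X ws"
    "computable T1" "\<And>w. gword_over X w \<Longrightarrow> T1 (gword_code w) = gword_code (t1 w)"
    "computable T1s" "\<And>ws. \<forall>w\<in>set ws. gword_over X w \<Longrightarrow>
       T1s (gwords_code ws) = gwords_code (map t1 ws)"
    by (fact gword_translation[OF G K.is_group l X X1])
  obtain t2 T2 T2s where t2:
    "\<And>w. gword_over X w \<Longrightarrow> gword_over X2 (t2 w)"
    "\<And>w. gword_over X w \<Longrightarrow> gword_val ?K X2 (t2 w) = ?l (gword_val G X w)"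
    "\<And>ws. \<forall>w\<in>set ws. gword_over X w \<Longrightarrow>
       gword_val ?K X2 ` set (map t2 ws) = ?l ` gword_val G X ` set ws"
    "\<And>ws. \<forall>w\<in>set ws. gword_over X w \<Longrightarrow>
       gword_span ?K X2 (map t2 ws) = ?l ` gword_span G X ws"
    "computable T2" "\<And>w. gword_over X w \<Longrightarrow> T2 (gword_code w) = gword_code (t2 w)"
    "computable T2s" "\<And>ws. \<forall>w\<in>set ws. gword_over X w \<Longrightarrow>
       T2s (gwords_code ws) = gwords_code (map t2 ws)"
    by (fact gword_translation[OF G K.is_group l X X2])
  obtain s1 S1 S1s where s1:
    "\<And>w. gword_over X1 w \<Longrightarrow> gword_over X' (s1 w)"
    "\<And>w. gword_over X1 w \<Longrightarrow> gword_val G' X' (s1 w) = \<phi> (gword_val ?K X1 w)"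
    "\<And>ws. \<forall>w\<in>set ws. gword_over X1 w \<Longrightarrow>
       gword_val G' X' ` set (map s1 ws) = \<phi> ` gword_val ?K X1 ` set ws"
    "\<And>ws. \<forall>w\<in>set ws. gword_over X1 w \<Longrightarrow>
       gword_span G' X' (map s1 ws) = \<phi> ` gword_span ?K X1 ws"
    "computable S1" "\<And>w. gword_over X1 w \<Longrightarrow> S1 (gword_code w) = gword_code (s1 w)"
    "computable S1s" "\<And>ws. \<forall>w\<in>set ws. gword_over X1 w \<Longrightarrow>
       S1s (gwords_code ws) = gwords_code (map s1 ws)"
    by (fact gword_translation[OF K.is_group G' \<phi> X1s X'])
  obtain s2 S2 S2s where s2:
    "\<And>w. gword_over X2 w \<Longrightarrow> gword_over X' (s2 w)"
    "\<And>w. gword_over X2 w \<Longrightarrow> gword_val G' X' (s2 w) = \<phi> (gword_val ?K X2 w)"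
    "\<And>ws. \<forall>w\<in>set ws. gword_over X2 w \<Longrightarrow>
       gword_val G' X' ` set (map s2 ws) = \<phi> ` gword_val ?K X2 ` set ws"
    "\<And>ws. \<forall>w\<in>set ws. gword_over X2 w \<Longrightarrow>
       gword_span G' X' (map s2 ws) = \<phi> ` gword_span ?K X2 ws"
    "computable S2" "\<And>w. gword_over X2 w \<Longrightarrow> S2 (gword_code w) = gword_code (s2 w)"
    "computable S2s" "\<And>ws. \<forall>w\<in>set ws. gword_over X2 w \<Longrightarrow>
       S2s (gwords_code ws) = gwords_code (map s2 ws)"
    by (fact gword_translation[OF K.is_group G' \<phi> X2s X'])
  obtain d where d: "gword_over X' d" "gword_val G' X' d = c"
    using \<phi>.H.gword_val_surj[OF X' c] by blast
  obtain gw where gw: "gword_over X2 gw" "gword_val ?K X2 gw = g"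
    using K.gword_val_surj[OF X2 g] by blast
  \<comment> \<open>The input of the eRHP algorithm presents \<open>L \<times> H\<close>. The input
    of the RCIP algorithm, \<open>in2\<close>, adds the word for \<open>g\<close> and the translated
    word for \<open>(y, 1)\<close>.\<close>
  define in1 where "in1 = (\<lambda>n. list_encode (list_decode (T1s (fst (prod_decode n))) @
    list_decode (gwords_code vs1)))"
  define in2 where "in2 = (\<lambda>n. prod_encode (list_encode (list_decode (T2s (fst (prod_decode n))) @
    list_decode (gwords_code vs2)), prod_encode (gword_code gw, T2 (snd (prod_decode n)))))"
  \<comment> \<open>The second component is the answer to RCIP: 0 for an empty intersection,
    otherwise the successor of the code of a representative.\<close>
  define out where "out = (\<lambda>p. if snd (prod_decode p) = 0 then 0 else
    Suc (prod_encode (S1s (fst (prod_decode p)),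
      list_encode (list_decode (S2 (snd (prod_decode p) - 1)) @ list_decode (gword_code d)))))"
  have "computable in1" "computable in2" "computable out"
    unfolding in1_def in2_def out_def
    by (intro computable_intros computable_comp[OF t1(7)] computable_comp[OF t2(5)]
      computable_comp[OF t2(7)] computable_comp[OF s1(7)] computable_comp[OF s2(5)])+
  then have "partial_recursive (\<lambda>n. Option.bind (Some (in1 n)) f1)"
    "partial_recursive (\<lambda>n. Option.bind (Some (in2 n)) f2)"
    "partial_recursive (\<lambda>p. Some (out p))"
    unfolding computable_def by (auto intro: partial_recursive.comp f1(1) f2(1) simp del: Option.bind.simps)
  \<comment> \<open>Both algorithms are run before the answer is inspected. The one from eRHP halts
    even if the cosets are disjoint, since its promise concerns only the tall subgroup.\<close>
  then have rec: "partial_recursive (\<lambda>n. Option.bind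
      (Option.bind (Option.bind (Some (in1 n)) f1) (\<lambda>a.
        Option.bind (Option.bind (Some (in2 n)) f2) (\<lambda>b. Some (prod_encode (a, b)))))
      (\<lambda>p. Some (out p)))"
    by (intro partial_recursive.comp[where f = "\<lambda>p. Some (out p)"] partial_recursive.pair)
  show ?thesis
  proof (rule right_coset_computableI, rule rec)
    fix ws x assume ws: "\<forall>w\<in>set ws. gword_over X w" and x: "gword_over X x"
    define L where "L = gword_span G X ws"
    define y where "y = gword_val G X x"
    have y: "y \<in> carrier G" using X x by (simp add: y_def)
    have L: "subgroup L G" unfolding L_def by (rule G.subgroup_gword_span[OF X ws])
    have tall: "L \<times> carrier H \<in> tall_subgroups G H"
      using L G.fin_gen_gword_span[OF X ws] by (auto simp: tall_subgroups_def L_def)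
    have LH: "subgroup (L \<times> carrier H) ?K"
      by (intro DirProd_subgroups G H L H.subgroup_self)
    have gY: "generate H (set (map snd X1)) = carrier H" "set (map snd X1) \<subseteq> carrier H"
      using Y by (auto simp: gen_list_def)
    \<comment> \<open>Generators of \<open>L\<close> in the first coordinate and the fixed
      generators of \<open>H\<close> in the second together generate the tall subgroup.\<close>
    have span: "gword_span ?K V (map t ws @ vs) = L \<times> carrier H"
      if "gword_val ?K V ` set (map t ws) = ?l ` gword_val G X ` set ws"
        "gword_val ?K V ` set vs = (\<lambda>h. (\<one>\<^bsub>G\<^esub>, h)) ` set (map snd X1)" for t V vs
      using generate_Times[OF G H G.gword_vals_subset[OF X ws] gY(2,1)]
      unfolding gword_span_def set_append image_Un that L_def .
    have span1: "gword_span ?K X1 (map t1 ws @ vs1) = L \<times> carrier H"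
      by (rule span[OF t1(3)[OF ws] vs1(2)])
    have span2: "gword_span ?K X2 (map t2 ws @ vs2) = L \<times> carrier H"
      by (rule span[OF t2(3)[OF ws] vs2(2)])
    have over1: "\<forall>w\<in>set (map t1 ws @ vs1). gword_over X1 w"
      and over2: "\<forall>w\<in>set (map t2 ws @ vs2). gword_over X2 w"
      using ws t1(1) t2(1) vs1(1) vs2(1) by auto
    define n where "n = prod_encode (gwords_code ws, gword_code x)"
    have in1: "in1 n = gwords_code (map t1 ws @ vs1)"
      unfolding in1_def n_def gwords_code_append using t1(8)[OF ws] by simp
    have in2: "in2 n = prod_encode (gwords_code (map t2 ws @ vs2),
        prod_encode (gword_code gw, gword_code (t2 x)))"
      unfolding in2_def n_def gwords_code_append using t2(6)[OF x] t2(8)[OF ws] by simp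
    obtain ws' where ws': "f1 (in1 n) = Some (gwords_code ws')"
      "\<forall>w\<in>set ws'. gword_over X1 w" "gword_span ?K X1 ws' = W \<inter> (L \<times> carrier H)"
      using f1(2)[OF over1] tall unfolding in1 span1 by auto
    define B where "B = (W #>\<^bsub>?K\<^esub> g) \<inter> ((L \<times> carrier H) #>\<^bsub>?K\<^esub> (y, \<one>\<^bsub>H\<^esub>))"
    have B: "((L #>\<^bsub>G\<^esub> y) \<times> carrier H) \<inter> (W #>\<^bsub>?K\<^esub> g) = B"
      unfolding r_coset_Times[OF G H y] B_def by auto
    have r: "if B = {} then f2 (in2 n) = Some 0
               else \<exists>z. f2 (in2 n) = Some (Suc (gword_code z)) \<and> gword_over X2 z \<and> gword_val ?K X2 z \<in> B"
      using f2(2)[OF over2 gw(1) t2(1)[OF x]] tall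
      unfolding Let_def span2 in2 gw(2) t2(2)[OF x] B_def y_def by simp
    have "right_coset_output G' X' ((\<lambda>z. \<phi> z \<otimes>\<^bsub>G'\<^esub> c) ` B)
      (Option.bind (Option.bind (Option.bind (Some (in1 n)) f1) (\<lambda>a.
        Option.bind (Option.bind (Some (in2 n)) f2) (\<lambda>b. Some (prod_encode (a, b)))))
        (\<lambda>p. Some (out p)))"
    proof (cases "B = {}")
      case True
      then show ?thesis using r by (simp add: right_coset_output_def ws'(1) out_def)
    next
      case False
      with r obtain z where z: "f2 (in2 n) = Some (Suc (gword_code z))" "gword_over X2 z"
        "gword_val ?K X2 z \<in> B" by auto
      have zc: "gword_val ?K X2 z \<in> carrier ?K" by (rule K.gword_val_closed[OF X2s z(2)])
      have out: "out (prod_encode (gwords_code ws', Suc (gword_code z))) =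
        Suc (prod_encode (gwords_code (map s1 ws'), gword_code (s2 z @ d)))"
        unfolding out_def gword_code_append using s1(8)[OF ws'(2)] s2(6)[OF z(2)] by simp
      have "B = (W \<inter> (L \<times> carrier H)) #>\<^bsub>?K\<^esub> gword_val ?K X2 z"
        unfolding B_def using z(3) y g unfolding B_def by (intro K.r_coset_Int W LH) auto
      then have "(\<lambda>z. \<phi> z \<otimes>\<^bsub>G'\<^esub> c) ` B =
        \<phi> ` (W \<inter> (L \<times> carrier H)) #>\<^bsub>G'\<^esub> (\<phi> (gword_val ?K X2 z) \<otimes>\<^bsub>G'\<^esub> c)"
        using \<phi>.image_r_coset[OF _ zc c, of "W \<inter> (L \<times> carrier H)"] subgroup.subset[OF W]
        by (simp only: le_infI1)
      also have "\<dots> = gword_span G' X' (map s1 ws') #>\<^bsub>G'\<^esub> gword_val G' X' (s2 z @ d)"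
        using s1(4)[OF ws'(2)] s2(1,2)[OF z(2)] d X's ws'(3) by (simp add: \<phi>.H.gword_val_append)
      finally have eq: "(\<lambda>z. \<phi> z \<otimes>\<^bsub>G'\<^esub> c) ` B =
        gword_span G' X' (map s1 ws') #>\<^bsub>G'\<^esub> gword_val G' X' (s2 z @ d)" .
      show ?thesis
        by (rule right_coset_outputI[OF _ _ _ _ eq]) (use False ws'(1,2) z s1(1) s2(1)[OF z(2)] d(1) out in auto)
    qed
    then show "right_coset_output G' X' ((\<lambda>z. \<phi> z \<otimes>\<^bsub>G'\<^esub> c) `
        ((gword_span G X ws #>\<^bsub>G\<^esub> gword_val G X x) \<times> carrier H \<inter> (W #>\<^bsub>?K\<^esub> g)))
      (Option.bind (Option.bind (Option.bind (Some (in1 (prod_encode (gwords_code ws, gword_code x)))) f1) (\<lambda>a.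
        Option.bind (Option.bind (Some (in2 (prod_encode (gwords_code ws, gword_code x)))) f2)
          (\<lambda>b. Some (prod_encode (a, b)))))
        (\<lambda>p. Some (out p)))"
      unfolding n_def[symmetric] y_def[symmetric] L_def[symmetric] B .
  qed
qed

section \<open>Translations of a completely 0-simple principal factor\<close>

lemma ig_cong_words:
  assumes "biordered_set TYPE('s) E" "(v, w) \<in> ig_cong E"
  shows "v \<in> nonempty_words E \<and> w \<in> nonempty_words E"
  using assms(2)
proof induction
  case (rel e f g)
  \<comment> \<open>The product of a basic pair is again a letter, by the closure condition
    contained in \<open>palg_iso\<close>.\<close>
  then have "g \<in> carrier E"
    using assms(1) unfolding biordered_set_def palg_iso_def basic_pair_def by fastforce
  with rel show ?case by (simp add: nonempty_words_def basic_pair_def)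
qed (auto simp: nonempty_words_def)

lemma equiv_ig_cong:
  assumes "biordered_set TYPE('s) E"
  shows "equiv (nonempty_words E) (ig_cong E)"
  using ig_cong_words[OF assms]
  by (intro equivI refl_onI symI transI) (auto intro: ig_cong.intros)

lemma nonempty_words_append:
  "v \<in> nonempty_words E \<Longrightarrow> w \<in> nonempty_words E \<Longrightarrow> v @ w \<in> nonempty_words E"
  by (simp add: nonempty_words_def)

lemma wbar_mult:
  assumes "biordered_set TYPE('s) E" "v \<in> nonempty_words E" "w \<in> nonempty_words E"
  shows "wbar E v \<odot>\<^bsub>IG E\<^esub> wbar E w = wbar E (v @ w)"
proof -
  note eq = equiv_ig_cong[OF assms(1)]
  have "ig_cong E `` {v' @ w'} = wbar E (v @ w)"
    if "v' \<in> wbar E v" "w' \<in> wbar E w" for v' w'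
    using that unfolding wbar_def by (intro equiv_class_eq[OF eq]) (auto intro: ig_cong.intros)
  moreover have "v \<in> wbar E v" "w \<in> wbar E w"
    using assms by (auto simp: wbar_def intro: ig_cong.refl)
  ultimately show ?thesis by (auto simp: IG_def)
qed

lemma IG_carrier: "carrier (IG E) = wbar E ` nonempty_words E"
  by (auto simp: IG_def wbar_def quotient_def)

lemma is_semigroup_IG:
  assumes "biordered_set TYPE('s) E"
  shows "is_semigroup (IG E)"
  unfolding is_semigroup_def IG_carrier
  by (auto simp: wbar_mult[OF assms] nonempty_words_append)

lemma Dclass_subset: "Dclass S a \<subseteq> carrier S"
  by (auto simp: Dclass_def greenD_def greenL_def greenR_def)

text \<open>Isolates what the labels need: multiplication by a fixed element that keeps one triple
  in \<open>D\<close> acts in the same way on all triples with the same row, respectively column,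
  index.\<close>

locale rees_class =
  fixes S :: "'a semigrp" and D :: "'a set" and K :: "('g, 'i, 'l, 'a) coords"
  assumes semigroup: "is_semigroup S" and D_subset: "D \<subseteq> carrier S"
    and coordinates: "rees_coordinates S D K"
begin

abbreviation "triples \<equiv> rows K \<times> carrier (grp K) \<times> cols K"

sublocale group "grp K"
  using coordinates by (simp add: rees_coordinates_def)

lemma bij_map_triple:
  "bij_betw (map_option (triple K)) (insert None (Some ` triples)) (insert None (Some ` D))"
  using coordinates
  by (auto simp: rees_coordinates_def semigroup_iso_def rees_matrix0_def principal_factor0_def)

text \<open>The option type carries a second piece of information: the product of two triples stays
  in \<open>D\<close> exactly when the sandwich entry is nonzero.\<close>

lemma map_triple_mult:
  assumes "(i, g, l) \<in> triples" "(j, h, \<mu>) \<in> triples"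
  shows "map_option (\<lambda>p. triple K (i, g \<otimes>\<^bsub>grp K\<^esub> p \<otimes>\<^bsub>grp K\<^esub> h, \<mu>)) (sandwich K l j) =
    (if triple K (i, g, l) \<odot>\<^bsub>S\<^esub> triple K (j, h, \<mu>) \<in> D
     then Some (triple K (i, g, l) \<odot>\<^bsub>S\<^esub> triple K (j, h, \<mu>)) else None)"
proof -
  let ?M = "rees_matrix0 (grp K) (rows K) (cols K) (sandwich K)" and ?P = "principal_factor0 S D"
  have "semigroup_iso ?M ?P (map_option (triple K))"
    using coordinates by (simp add: rees_coordinates_def)
  then have "map_option (triple K) (Some (i, g, l) \<odot>\<^bsub>?M\<^esub> Some (j, h, \<mu>)) =
    map_option (triple K) (Some (i, g, l)) \<odot>\<^bsub>?P\<^esub> map_option (triple K) (Some (j, h, \<mu>))"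
    using assms unfolding semigroup_iso_def by (auto simp: rees_matrix0_def)
  then show ?thesis
    by (simp add: rees_matrix0_def principal_factor0_def option.map_comp comp_def)
qed

lemma bij_triple: "bij_betw (triple K) triples D"
proof -
  have "inj_on (triple K) triples"
    using bij_map_triple unfolding bij_betw_def inj_on_def by force
  moreover have "map_option (triple K) ` insert None (Some ` triples) = insert None (Some ` triple K ` triples)"
    by (simp add: image_image)
  then have "insert None (Some ` triple K ` triples) = insert None (Some ` D)"
    using bij_map_triple unfolding bij_betw_def by simp
  then have "triple K ` triples = D"
    by (auto simp: set_eq_iff)
  ultimately show ?thesis by (simp add: bij_betw_def)
qed

lemma triple_in_D: "t \<in> triples \<Longrightarrow> triple K t \<in> D"
  using bij_triple by (auto simp: bij_betw_def)

lemma D_cases: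
  assumes "x \<in> D"
  obtains i g l where "(i, g, l) \<in> triples" "x = triple K (i, g, l)"
proof -
  have "x \<in> triple K ` triples" using assms bij_triple by (simp add: bij_betw_def)
  then show ?thesis using that by auto
qed

lemma triple_eq_iff: "\<lbrakk>s \<in> triples; t \<in> triples\<rbrakk> \<Longrightarrow> triple K s = triple K t \<longleftrightarrow> s = t"
  using bij_triple by (auto simp: bij_betw_def inj_on_eq_iff)

lemma triple_mult:
  assumes "(i, g, l) \<in> triples" "(j, h, \<mu>) \<in> triples"
    and "triple K (i, g, l) \<odot>\<^bsub>S\<^esub> triple K (j, h, \<mu>) \<in> D \<or> sandwich K l j \<noteq> None"
  shows "triple K (i, g, l) \<odot>\<^bsub>S\<^esub> triple K (j, h, \<mu>) =
    triple K (i, g \<otimes>\<^bsub>grp K\<^esub> the (sandwich K l j) \<otimes>\<^bsub>grp K\<^esub> h, \<mu>)"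
  using map_triple_mult[OF assms(1,2)] assms(3)
  by (cases "sandwich K l j") (auto split: if_splits)

lemma sandwich_closed:
  "\<lbrakk>l \<in> cols K; i \<in> rows K; sandwich K l i \<noteq> None\<rbrakk> \<Longrightarrow> the (sandwich K l i) \<in> carrier (grp K)"
  using coordinates by (fastforce simp: rees_coordinates_def)

lemma inv_cancel_left:
  assumes "x \<in> carrier (grp K)" "y \<in> carrier (grp K)"
  shows "x \<otimes>\<^bsub>grp K\<^esub> (inv\<^bsub>grp K\<^esub> x \<otimes>\<^bsub>grp K\<^esub> y) = y"
  using assms by (simp add: m_assoc[symmetric])

lemma assoc:
  "\<lbrakk>x \<in> carrier S; y \<in> carrier S; z \<in> carrier S\<rbrakk> \<Longrightarrow> x \<odot>\<^bsub>S\<^esub> y \<odot>\<^bsub>S\<^esub> z = x \<odot>\<^bsub>S\<^esub> (y \<odot>\<^bsub>S\<^esub> z)"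
  using semigroup by (simp add: is_semigroup_def)

(* Compare e s with (e s) f, where f = (j, p^-1, l) is an idempotent with s f = s for s = (i, g, l). *)
lemma left_translation:
  assumes "e \<in> carrier S" "(i, g, l) \<in> triples" "e \<odot>\<^bsub>S\<^esub> triple K (i, g, l) \<in> D"
  shows "\<exists>i'\<in>rows K. \<exists>x\<in>carrier (grp K). \<forall>g\<in>carrier (grp K). \<forall>l\<in>cols K.
    e \<odot>\<^bsub>S\<^esub> triple K (i, g, l) = triple K (i', x \<otimes>\<^bsub>grp K\<^esub> g, l)"
proof -
  obtain i' h \<mu> where h: "(i', h, \<mu>) \<in> triples" "e \<odot>\<^bsub>S\<^esub> triple K (i, g, l) = triple K (i', h, \<mu>)"
    using assms(3) by (rule D_cases)
  obtain j where j: "j \<in> rows K" "sandwich K l j \<noteq> None"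
    using assms(2) coordinates unfolding rees_coordinates_def by auto
  define p where "p = the (sandwich K l j)"
  have p: "p \<in> carrier (grp K)" using j assms(2) sandwich_closed by (auto simp: p_def)
  have mult: "triple K (i', h, \<mu>) \<odot>\<^bsub>S\<^esub> triple K (j, k, \<nu>) = e \<odot>\<^bsub>S\<^esub> triple K (i, g \<otimes>\<^bsub>grp K\<^esub> p \<otimes>\<^bsub>grp K\<^esub> k, \<nu>)"
    if "k \<in> carrier (grp K)" "\<nu> \<in> cols K" for k \<nu>
  proof -
    have t: "(j, k, \<nu>) \<in> triples" using that j by simp
    have "triple K (i', h, \<mu>) \<odot>\<^bsub>S\<^esub> triple K (j, k, \<nu>) =
      e \<odot>\<^bsub>S\<^esub> (triple K (i, g, l) \<odot>\<^bsub>S\<^esub> triple K (j, k, \<nu>))"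
      unfolding h(2)[symmetric] using assms t triple_in_D D_subset by (intro assoc) auto
    also have "triple K (i, g, l) \<odot>\<^bsub>S\<^esub> triple K (j, k, \<nu>) = triple K (i, g \<otimes>\<^bsub>grp K\<^esub> p \<otimes>\<^bsub>grp K\<^esub> k, \<nu>)"
      unfolding p_def using assms t j by (intro triple_mult) auto
    finally show ?thesis .
  qed
  let ?f = "(j, inv\<^bsub>grp K\<^esub> p, l)"
  have f: "?f \<in> triples" using j p assms(2) by simp
  have eq: "triple K (i', h, \<mu>) \<odot>\<^bsub>S\<^esub> triple K ?f = triple K (i', h, \<mu>)"
    using mult[of "inv\<^bsub>grp K\<^esub> p" l] h assms(2) p by (simp add: m_assoc)
  then have inD: "triple K (i', h, \<mu>) \<odot>\<^bsub>S\<^esub> triple K ?f \<in> D"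
    using triple_in_D[OF h(1)] by simp
  have "sandwich K \<mu> j \<noteq> None"
    using map_triple_mult[OF h(1) f] inD by (auto split: if_splits)
  then have "the (sandwich K \<mu> j) \<in> carrier (grp K)"
    using h(1) j(1) sandwich_closed by auto
  then have "(i', h \<otimes>\<^bsub>grp K\<^esub> the (sandwich K \<mu> j) \<otimes>\<^bsub>grp K\<^esub> inv\<^bsub>grp K\<^esub> p, l) \<in> triples"
    using h(1) f by auto
  moreover have "triple K (i', h, \<mu>) =
      triple K (i', h \<otimes>\<^bsub>grp K\<^esub> the (sandwich K \<mu> j) \<otimes>\<^bsub>grp K\<^esub> inv\<^bsub>grp K\<^esub> p, l)"
    using triple_mult[OF h(1) f] inD eq by simp
  \<comment> \<open>The product with \<open>f\<close> ends in \<open>l\<close>, the last index of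
    \<open>f\<close>, and it equals \<open>e s\<close>; so left multiplication preserves the last
    index.\<close>
  ultimately have \<mu>: "\<mu> = l"
    using triple_eq_iff[OF h(1)] by simp
  have "e \<odot>\<^bsub>S\<^esub> triple K (i, k, \<nu>) = triple K (i', (h \<otimes>\<^bsub>grp K\<^esub> inv\<^bsub>grp K\<^esub> g) \<otimes>\<^bsub>grp K\<^esub> k, \<nu>)"
    if k: "k \<in> carrier (grp K)" "\<nu> \<in> cols K" for k \<nu>
  proof -
    \<comment> \<open>Chosen so that \<open>x p q = x g^-1 k\<close>: for \<open>x = g\<close> this
      is \<open>k\<close>, and for \<open>x = h\<close> it is the value of the translated
      triple.\<close>
    define q where "q = inv\<^bsub>grp K\<^esub> p \<otimes>\<^bsub>grp K\<^esub> (inv\<^bsub>grp K\<^esub> g \<otimes>\<^bsub>grp K\<^esub> k)"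
    have q: "q \<in> carrier (grp K)" using p k assms(2) by (auto simp: q_def)
    have c: "x \<otimes>\<^bsub>grp K\<^esub> p \<otimes>\<^bsub>grp K\<^esub> q = x \<otimes>\<^bsub>grp K\<^esub> inv\<^bsub>grp K\<^esub> g \<otimes>\<^bsub>grp K\<^esub> k" if "x \<in> carrier (grp K)" for x
      using that p k assms(2) by (simp add: q_def m_assoc inv_cancel_left)
    have "triple K (i', h, l) \<odot>\<^bsub>S\<^esub> triple K (j, q, \<nu>) = triple K (i', h \<otimes>\<^bsub>grp K\<^esub> p \<otimes>\<^bsub>grp K\<^esub> q, \<nu>)"
      unfolding p_def using h(1) \<mu> q j k by (intro triple_mult) auto
    then show ?thesis
      using mult[OF q k(2)] c[of g] c[of h] h(1) assms(2) k by (simp add: \<mu>)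
  qed
  then show ?thesis
    using h(1) assms(2) by (intro bexI[of _ i'] bexI[of _ "h \<otimes>\<^bsub>grp K\<^esub> inv\<^bsub>grp K\<^esub> g"]) auto
qed

text \<open>Mirror image of \<open>left_translation\<close>: the idempotent
  \<open>(i, p^-1, j)\<close> fixes \<open>s\<close> from the left, so the nonzero sandwich entry is
  taken at \<open>i\<close> instead of \<open>l\<close>.\<close>

lemma right_translation:
  assumes "e \<in> carrier S" "(i, g, l) \<in> triples" "triple K (i, g, l) \<odot>\<^bsub>S\<^esub> e \<in> D"
  shows "\<exists>l'\<in>cols K. \<exists>x\<in>carrier (grp K). \<forall>i\<in>rows K. \<forall>g\<in>carrier (grp K).
    triple K (i, g, l) \<odot>\<^bsub>S\<^esub> e = triple K (i, g \<otimes>\<^bsub>grp K\<^esub> x, l')"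
proof -
  obtain i' h \<mu> where h: "(i', h, \<mu>) \<in> triples" "triple K (i, g, l) \<odot>\<^bsub>S\<^esub> e = triple K (i', h, \<mu>)"
    using assms(3) by (rule D_cases)
  obtain j where j: "j \<in> cols K" "sandwich K j i \<noteq> None"
    using assms(2) coordinates unfolding rees_coordinates_def by auto
  define p where "p = the (sandwich K j i)"
  have p: "p \<in> carrier (grp K)" using j assms(2) sandwich_closed by (auto simp: p_def)
  have mult: "triple K (\<nu>, k, j) \<odot>\<^bsub>S\<^esub> triple K (i', h, \<mu>) = triple K (\<nu>, k \<otimes>\<^bsub>grp K\<^esub> p \<otimes>\<^bsub>grp K\<^esub> g, l) \<odot>\<^bsub>S\<^esub> e"
    if "k \<in> carrier (grp K)" "\<nu> \<in> rows K" for k \<nu>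
  proof -
    have t: "(\<nu>, k, j) \<in> triples" using that j by simp
    have "triple K (\<nu>, k, j) \<odot>\<^bsub>S\<^esub> triple K (i', h, \<mu>) =
      triple K (\<nu>, k, j) \<odot>\<^bsub>S\<^esub> triple K (i, g, l) \<odot>\<^bsub>S\<^esub> e"
      unfolding h(2)[symmetric] using assms t triple_in_D D_subset by (intro assoc[symmetric]) auto
    also have "triple K (\<nu>, k, j) \<odot>\<^bsub>S\<^esub> triple K (i, g, l) = triple K (\<nu>, k \<otimes>\<^bsub>grp K\<^esub> p \<otimes>\<^bsub>grp K\<^esub> g, l)"
      unfolding p_def using assms t j by (intro triple_mult) auto
    finally show ?thesis .
  qed
  let ?f = "(i, inv\<^bsub>grp K\<^esub> p, j)"
  have f: "?f \<in> triples" using j p assms(2) by simp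
  have eq: "triple K ?f \<odot>\<^bsub>S\<^esub> triple K (i', h, \<mu>) = triple K (i', h, \<mu>)"
    using mult[of "inv\<^bsub>grp K\<^esub> p" i] h assms(2) p by simp
  then have inD: "triple K ?f \<odot>\<^bsub>S\<^esub> triple K (i', h, \<mu>) \<in> D"
    using triple_in_D[OF h(1)] by simp
  have "sandwich K j i' \<noteq> None"
    using map_triple_mult[OF f h(1)] inD by (auto split: if_splits)
  then have "the (sandwich K j i') \<in> carrier (grp K)"
    using h(1) j(1) sandwich_closed by auto
  then have "(i, inv\<^bsub>grp K\<^esub> p \<otimes>\<^bsub>grp K\<^esub> the (sandwich K j i') \<otimes>\<^bsub>grp K\<^esub> h, \<mu>) \<in> triples"
    using h(1) f by auto
  moreover have "triple K (i', h, \<mu>) =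
      triple K (i, inv\<^bsub>grp K\<^esub> p \<otimes>\<^bsub>grp K\<^esub> the (sandwich K j i') \<otimes>\<^bsub>grp K\<^esub> h, \<mu>)"
    using triple_mult[OF f h(1)] inD eq by simp
  ultimately have i': "i' = i"
    using triple_eq_iff[OF h(1)] by simp
  have "triple K (\<nu>, k, l) \<odot>\<^bsub>S\<^esub> e = triple K (\<nu>, k \<otimes>\<^bsub>grp K\<^esub> (inv\<^bsub>grp K\<^esub> g \<otimes>\<^bsub>grp K\<^esub> h), \<mu>)"
    if k: "k \<in> carrier (grp K)" "\<nu> \<in> rows K" for k \<nu>
  proof -
    define q where "q = k \<otimes>\<^bsub>grp K\<^esub> inv\<^bsub>grp K\<^esub> g \<otimes>\<^bsub>grp K\<^esub> inv\<^bsub>grp K\<^esub> p"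
    have q: "q \<in> carrier (grp K)" using p k assms(2) by (auto simp: q_def)
    have c: "q \<otimes>\<^bsub>grp K\<^esub> p \<otimes>\<^bsub>grp K\<^esub> x = k \<otimes>\<^bsub>grp K\<^esub> (inv\<^bsub>grp K\<^esub> g \<otimes>\<^bsub>grp K\<^esub> x)" if "x \<in> carrier (grp K)" for x
      using that p k assms(2) by (simp add: q_def m_assoc inv_cancel_left)
    have "triple K (\<nu>, q, j) \<odot>\<^bsub>S\<^esub> triple K (i, h, \<mu>) = triple K (\<nu>, q \<otimes>\<^bsub>grp K\<^esub> p \<otimes>\<^bsub>grp K\<^esub> h, \<mu>)"
      unfolding p_def using h(1) i' q j k by (intro triple_mult) auto
    then show ?thesis
      using mult[OF q k(2)] c[of g] c[of h] h(1) assms(2) k by (simp add: i')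
  qed
  then show ?thesis
    using h(1) assms(2) by (intro bexI[of _ \<mu>] bexI[of _ "inv\<^bsub>grp K\<^esub> g \<otimes>\<^bsub>grp K\<^esub> h"]) auto
qed

end

section \<open>Walks in the contact automaton\<close>

context
  fixes E :: "'e palg" and C :: "'e list set set \<Rightarrow> ('g, 'i, 'l, 'e list set) coords"
    and D :: "'e list set set"
  assumes E: "biordered_set TYPE('s) E" and D: "regular_Dclass (IG E) D"
    and C: "rees_coordinates (IG E) D (C D)"
begin

interpretation rees_class "IG E" D "C D"
  using is_semigroup_IG[OF E] D C Dclass_subset
  unfolding rees_class_def regular_Dclass_def by metis

lemma wbar_letter: "e \<in> carrier E \<Longrightarrow> wbar E [e] \<in> carrier (IG E)"
  by (auto simp: IG_carrier nonempty_words_def)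

lemma alpha_closed:
  assumes "e \<in> carrier E" "i \<in> rows (C D)" "sigma E C D e i = Some j"
  shows "alpha E C D e i \<in> carrier (grp (C D))"
proof -
  obtain g l where gl: "g \<in> carrier (grp (C D))" "l \<in> cols (C D)"
    "wbar E [e] \<odot>\<^bsub>IG E\<^esub> triple (C D) (i, g, l) \<in> D"
    using assms(3) by (auto simp: sigma_def split: if_splits)
  then obtain i' x where x: "left_act E (C D) e i i' x"
    using left_translation[OF wbar_letter[OF assms(1)], of i g l] assms(2) unfolding left_act_def
    by auto
  \<comment> \<open>\<open>alpha\<close> is a definite description and needs uniqueness of the
    multiplier, which follows by evaluation at the identity of the group.\<close>
  have "y = x" if "left_act E (C D) e i j y" for j y
  proof -
    have "triple (C D) (i', x \<otimes>\<^bsub>grp (C D)\<^esub> \<one>\<^bsub>grp (C D)\<^esub>, l) = triple (C D) (j, y \<otimes>\<^bsub>grp (C D)\<^esub> \<one>\<^bsub>grp (C D)\<^esub>, l)"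
      using x that gl(2) unfolding left_act_def by (metis one_closed)
    then show ?thesis
      using x that gl(2) by (simp add: left_act_def triple_eq_iff)
  qed
  then have "alpha E C D e i = x"
    unfolding alpha_def using x by blast
  then show ?thesis using x by (simp add: left_act_def)
qed

lemma beta_closed:
  assumes "e \<in> carrier E" "l \<in> cols (C D)" "tau E C D l e = Some \<mu>"
  shows "beta E C D l e \<in> carrier (grp (C D))"
proof -
  obtain g i where gi: "g \<in> carrier (grp (C D))" "i \<in> rows (C D)"
    "triple (C D) (i, g, l) \<odot>\<^bsub>IG E\<^esub> wbar E [e] \<in> D"
    using assms(3) by (auto simp: tau_def split: if_splits)
  then obtain l' x where x: "right_act E (C D) l e l' x"
    using right_translation[OF wbar_letter[OF assms(1)], of i g l] assms(2) unfolding right_act_def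
    by auto
  have "y = x" if "right_act E (C D) l e j y" for j y
  proof -
    have "triple (C D) (i, \<one>\<^bsub>grp (C D)\<^esub> \<otimes>\<^bsub>grp (C D)\<^esub> x, l') = triple (C D) (i, \<one>\<^bsub>grp (C D)\<^esub> \<otimes>\<^bsub>grp (C D)\<^esub> y, j)"
      using x that gi(2) unfolding right_act_def by (metis one_closed)
    then show ?thesis
      using x that gi(2) by (simp add: right_act_def triple_eq_iff)
  qed
  then have "beta E C D l e = x"
    unfolding beta_def using x by blast
  then show ?thesis using x by (simp add: right_act_def)
qed

end

text \<open>The arguments about walks use only that the labels lie in the two groups; nothing else
  is kept of the biordered set.\<close>

locale contact =
  fixes E :: "'e palg" and C :: "'e list set set \<Rightarrow> ('g, 'i, 'l, 'e list set) coords"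
    and D\<^sub>1 D\<^sub>2 :: "'e list set set"
  assumes group1: "group (grp (C D\<^sub>1))" and group2: "group (grp (C D\<^sub>2))"
    and beta_in: "\<lbrakk>e \<in> carrier E; l \<in> cols (C D\<^sub>1); tau E C D\<^sub>1 l e = Some \<mu>\<rbrakk> \<Longrightarrow>
       beta E C D\<^sub>1 l e \<in> carrier (grp (C D\<^sub>1))"
    and alpha_in: "\<lbrakk>e \<in> carrier E; i \<in> rows (C D\<^sub>2); sigma E C D\<^sub>2 e i = Some j\<rbrakk> \<Longrightarrow>
       alpha E C D\<^sub>2 e i \<in> carrier (grp (C D\<^sub>2))"
begin

abbreviation "K \<equiv> contact_group C D\<^sub>1 D\<^sub>2"

lemma carrier_contact: "carrier K = carrier (grp (C D\<^sub>1)) \<times> carrier (grp (C D\<^sub>2))"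
  by (simp add: contact_group_def)

sublocale group K
  unfolding contact_group_def by (intro DirProd_group group1 group.group_dual_group group2)

lemma edge_label: "contact_edge E C D\<^sub>1 D\<^sub>2 v e x w \<Longrightarrow> x \<in> carrier K"
  by (induction rule: contact_edge.induct)
    (auto simp: carrier_contact alpha_in beta_in group.inv_closed[OF group1] group.inv_closed[OF group2])

lemma edge_vertices:
  "contact_edge E C D\<^sub>1 D\<^sub>2 v e x w \<Longrightarrow>
     v \<in> cols (C D\<^sub>1) \<times> rows (C D\<^sub>2) \<and> w \<in> cols (C D\<^sub>1) \<times> rows (C D\<^sub>2)"
  by (induction rule: contact_edge.induct) auto

lemma walk_closed: "contact_walk E C D\<^sub>1 D\<^sub>2 v x w \<Longrightarrow> x \<in> carrier K"
  by (induction rule: contact_walk.induct) (auto simp: edge_label)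

lemma walk_append:
  assumes "contact_walk E C D\<^sub>1 D\<^sub>2 v x w" "contact_walk E C D\<^sub>1 D\<^sub>2 w y z"
  shows "contact_walk E C D\<^sub>1 D\<^sub>2 v (x \<otimes>\<^bsub>K\<^esub> y) z"
  using assms
proof (induction rule: contact_walk.induct)
  case (forward v e x v' x' w)
  then show ?case
    using contact_walk.forward[of E C D\<^sub>1 D\<^sub>2 v e x v' "x' \<otimes>\<^bsub>K\<^esub> y" z]
    by (simp add: m_assoc edge_label walk_closed)
next
  case (backward v' e x v x' w)
  then show ?case
    using contact_walk.backward[of E C D\<^sub>1 D\<^sub>2 v' e x v "x' \<otimes>\<^bsub>K\<^esub> y" z]
    by (simp add: m_assoc edge_label walk_closed)
qed (simp add: walk_closed)

lemma walk_inv: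
  assumes "contact_walk E C D\<^sub>1 D\<^sub>2 v x w"
  shows "contact_walk E C D\<^sub>1 D\<^sub>2 w (inv\<^bsub>K\<^esub> x) v"
  using assms
proof (induction rule: contact_walk.induct)
  case (empty v)
  then show ?case by (simp add: contact_walk.empty)
next
  case (forward v e x v' y w)
  \<comment> \<open>Walks grow at the front, so the reversed edge becomes a one-edge walk, ending in
    the empty walk, and is appended to the reversed remainder.\<close>
  have "contact_walk E C D\<^sub>1 D\<^sub>2 v' (inv\<^bsub>K\<^esub> x \<otimes>\<^bsub>K\<^esub> \<one>\<^bsub>K\<^esub>) v"
    using forward edge_vertices by (blast intro: contact_walk.backward contact_walk.empty)
  from walk_append[OF forward.IH this] show ?case
    using forward by (simp add: edge_label walk_closed inv_mult_group)
next
  case (backward v' e x v y w)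
  have "contact_walk E C D\<^sub>1 D\<^sub>2 v' (x \<otimes>\<^bsub>K\<^esub> \<one>\<^bsub>K\<^esub>) v"
    using backward edge_vertices by (blast intro: contact_walk.forward contact_walk.empty)
  from walk_append[OF backward.IH this] show ?case
    using backward by (simp add: edge_label walk_closed inv_mult_group)
qed

lemma subgroup_vertex_group:
  assumes "v \<in> cols (C D\<^sub>1) \<times> rows (C D\<^sub>2)"
  shows "subgroup (vertex_group E C D\<^sub>1 D\<^sub>2 v) K"
  using assms walk_closed walk_append walk_inv
  by (intro subgroup.intro) (auto simp: vertex_group_def intro: contact_walk.empty)

text \<open>Forgets which label \<open>SOME\<close> selects: the iteration only needs a right coset
  of the vertex group or the empty set.\<close>

lemma walk_coset_cases:
  obtains "walk_coset E C D\<^sub>1 D\<^sub>2 v w = {}"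
  | g where "g \<in> carrier K" "walk_coset E C D\<^sub>1 D\<^sub>2 v w = vertex_group E C D\<^sub>1 D\<^sub>2 v #>\<^bsub>K\<^esub> g"
  unfolding walk_coset_def using walk_closed by (metis someI_ex)

end

section \<open>The iteration of theta\<close>

text \<open>The flag lets one induction serve both (1) and (2): finite generation is demanded only
  when it is \<open>True\<close>.\<close>

definition is_right_coset :: "bool \<Rightarrow> ('a, 'b) monoid_scheme \<Rightarrow> 'a set \<Rightarrow> bool" where
  "is_right_coset fg G Z \<longleftrightarrow>
     (\<exists>L x. subgroup L G \<and> (fg \<longrightarrow> fin_gen G L) \<and> x \<in> carrier G \<and> Z = L #>\<^bsub>G\<^esub> x)"

lemma (in group_hom) is_right_coset_image:
  assumes "is_right_coset fg G Z" "c \<in> carrier H"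
  shows "is_right_coset fg H ((\<lambda>z. h z \<otimes>\<^bsub>H\<^esub> c) ` Z)"
proof -
  obtain L x where L: "subgroup L G" "fg \<longrightarrow> fin_gen G L" "x \<in> carrier G" "Z = L #> x"
    using assms(1) by (auto simp: is_right_coset_def)
  then show ?thesis
    unfolding is_right_coset_def using image_r_coset[OF subgroup.subset[OF L(1)] L(3) assms(2)]
      subgroup_img_is_subgroup[OF L(1)] fin_gen_hom_image[of L] assms(2)
    by (intro exI[of _ "h ` L"] exI[of _ "h x \<otimes>\<^bsub>H\<^esub> c"]) auto
qed

lemma (in group) is_right_coset_dual_group:
  assumes "is_right_coset fg G Z"
  shows "is_right_coset fg (dual_group G) Z"
proof -
  obtain L x where L: "subgroup L G" "fg \<longrightarrow> fin_gen G L" "x \<in> carrier G" "Z = L #> x"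
    using assms by (auto simp: is_right_coset_def)
  let ?\<psi> = "\<lambda>h. inv x \<otimes> h \<otimes> x"
  interpret group_hom G G ?\<psi>
    using conjugation_hom[OF L(3)] by (simp add: group_hom_def group_hom_axioms_def is_group)
  have "subgroup (?\<psi> ` L) G" "fg \<longrightarrow> fin_gen G (?\<psi> ` L)"
    using subgroup_img_is_subgroup[OF L(1)] fin_gen_hom_image[of L] L(2) by auto
  then show ?thesis
    unfolding is_right_coset_def using r_coset_eq_l_coset[OF subgroup.subset[OF L(1)] L(3)] L(3,4)
    by (intro exI[of _ "?\<psi> ` L"] exI[of _ x]) simp
qed

text \<open>If \<open>L\<close> is finitely generated, then \<open>L \<times> H\<close> is tall, and
  the relative Howson property applies to its intersection with \<open>W\<close>.\<close>

lemma is_right_coset_Int_tall: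
  assumes "group G" "group H" "is_right_coset fg G Z" "subgroup W (G \<times>\<times> H)" "g \<in> carrier (G \<times>\<times> H)"
    and "fg \<longrightarrow> rel_Howson (G \<times>\<times> H) W (tall_subgroups G H)"
    and "(Z \<times> carrier H) \<inter> (W #>\<^bsub>G \<times>\<times> H\<^esub> g) \<noteq> {}"
  shows "is_right_coset fg (G \<times>\<times> H) ((Z \<times> carrier H) \<inter> (W #>\<^bsub>G \<times>\<times> H\<^esub> g))"
proof -
  interpret G: group G by fact
  interpret H: group H by fact
  interpret K: group "G \<times>\<times> H" by (intro DirProd_group assms)
  obtain L x where L: "subgroup L G" "fg \<longrightarrow> fin_gen G L" "x \<in> carrier G" "Z = L #>\<^bsub>G\<^esub> x"
    using assms(3) by (auto simp: is_right_coset_def)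
  have LH: "subgroup (L \<times> carrier H) (G \<times>\<times> H)"
    by (intro DirProd_subgroups assms L H.subgroup_self)
  have eq: "(Z \<times> carrier H) \<inter> (W #>\<^bsub>G \<times>\<times> H\<^esub> g) =
    (W #>\<^bsub>G \<times>\<times> H\<^esub> g) \<inter> ((L \<times> carrier H) #>\<^bsub>G \<times>\<times> H\<^esub> (x, \<one>\<^bsub>H\<^esub>))"
    unfolding L(4) r_coset_Times[OF assms(1,2) L(3)] by auto
  obtain z where z: "z \<in> (W #>\<^bsub>G \<times>\<times> H\<^esub> g) \<inter> ((L \<times> carrier H) #>\<^bsub>G \<times>\<times> H\<^esub> (x, \<one>\<^bsub>H\<^esub>))"
    using assms(7) unfolding eq by blast
  then have zc: "z \<in> carrier (G \<times>\<times> H)"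
    using K.r_coset_subset_G[OF subgroup.subset[OF assms(4)] assms(5)] by blast
  have "L \<times> carrier H \<in> tall_subgroups G H" if fg
    using that L(1,2) by (auto simp: tall_subgroups_def)
  then have "fg \<longrightarrow> fin_gen (G \<times>\<times> H) (W \<inter> (L \<times> carrier H))"
    using assms(6) by (simp add: rel_Howson_def)
  moreover have "subgroup (W \<inter> (L \<times> carrier H)) (G \<times>\<times> H)"
    by (intro K.subgroups_Inter_pair assms LH)
  moreover have "(Z \<times> carrier H) \<inter> (W #>\<^bsub>G \<times>\<times> H\<^esub> g) = (W \<inter> (L \<times> carrier H)) #>\<^bsub>G \<times>\<times> H\<^esub> z"
    unfolding eq using L(3) by (intro K.r_coset_Int assms LH z) simp
  ultimately show ?thesis
    unfolding is_right_coset_def using zc by blast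
qed

text \<open>Part (2) concerns every \<open>M\<close> with \<open>\<Theta> = y M\<close>, whereas the
  induction produces one finitely generated subgroup; uniqueness identifies the two.\<close>

lemma (in group) r_coset_subgroup_unique:
  assumes "subgroup M G" "subgroup M' G" "y \<in> carrier G" "x \<in> carrier G" "M #> y = M' #> x"
  shows "M = M'"
proof -
  have "y \<in> M' #> x" using rcos_self[OF assms(3,1)] assms(5) by simp
  then have "M #> y = M' #> y"
    using repr_independence[OF _ assms(4,2)] assms(5) by simp
  then have "(M #> y) #> inv y = (M' #> y) #> inv y" by simp
  then show ?thesis
    using assms(1-4) by (simp add: coset_mult_assoc subgroup.subset)
qed

lemma (in group) inverse_conjugation_hom:
  "y \<in> carrier G \<Longrightarrow> (\<lambda>h. inv y \<otimes> inv h \<otimes> y) \<in> hom (dual_group G) G"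
  using conjugation_hom[of y] unfolding hom_def by (auto simp: inv_mult_group)

section \<open>The two alternating steps of theta\<close>

locale contact_chain =
  fixes E :: "'e palg" and C :: "'e list set set \<Rightarrow> ('g, 'i, 'l, 'e list set) coords"
    and D :: "nat \<Rightarrow> 'e list set set" and m :: nat and s t :: "nat \<Rightarrow> 'i \<times> 'g \<times> 'l"
  assumes group: "\<And>k. k \<in> {1..m} \<Longrightarrow> group (grp (C (D k)))"
    and contact: "\<And>k. \<lbrakk>1 \<le> k; k < m\<rbrakk> \<Longrightarrow> contact E C (D k) (D (Suc k))"
    and s_in: "\<And>k. k \<in> {1..m} \<Longrightarrow> s k \<in> rows (C (D k)) \<times> carrier (grp (C (D k))) \<times> cols (C (D k))"
    and t_in: "\<And>k. k \<in> {1..m} \<Longrightarrow> t k \<in> rows (C (D k)) \<times> carrier (grp (C (D k))) \<times> cols (C (D k))"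
begin

abbreviation "G k \<equiv> grp (C (D k))"
abbreviation "P k \<equiv> contact_group C (D k) (D (Suc k))"
abbreviation "W k \<equiv> vertex_group E C (D k) (D (Suc k)) (snd (snd (s k)), fst (s (Suc k)))"
abbreviation "V k \<equiv> walk_coset E C (D k) (D (Suc k)) (snd (snd (s k)), fst (s (Suc k)))
  (snd (snd (t k)), fst (t (Suc k)))"
abbreviation "A k X \<equiv> theta_A E C D s t X k"

(* The first factor of the product intersected with the coset of W k in the definition of B_{k,k+1}. *)
definition factor :: "nat \<Rightarrow> 'g set \<Rightarrow> 'g set" where
  "factor k X = (if k = 1 then X
     else {inv\<^bsub>G k\<^esub> (fst (snd (s k))) \<otimes>\<^bsub>G k\<^esub> inv\<^bsub>G k\<^esub> x \<otimes>\<^bsub>G k\<^esub> fst (snd (t k)) |x. x \<in> A k X})"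

text \<open>The multiplication by the identity gives the projection the shape
  \<open>\<phi> z \<otimes> c\<close>, which it then shares with \<open>invert_step\<close>, so that
  the same image lemmas apply to both.\<close>

definition contact_step :: "nat \<Rightarrow> 'g set \<Rightarrow> 'g set" where
  "contact_step k Z = (\<lambda>z. snd z \<otimes>\<^bsub>dual_group (G (Suc k))\<^esub> \<one>\<^bsub>dual_group (G (Suc k))\<^esub>) `
     ((Z \<times> carrier (G (Suc k))) \<inter> V k)"

definition invert_step :: "nat \<Rightarrow> 'g set \<Rightarrow> 'g set" where
  "invert_step k Z = (\<lambda>z. (inv\<^bsub>G k\<^esub> (fst (snd (s k))) \<otimes>\<^bsub>G k\<^esub> inv\<^bsub>G k\<^esub> z \<otimes>\<^bsub>G k\<^esub> fst (snd (s k)))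
     \<otimes>\<^bsub>G k\<^esub> (inv\<^bsub>G k\<^esub> (fst (snd (s k))) \<otimes>\<^bsub>G k\<^esub> fst (snd (t k)))) ` Z"

lemma s_val: "k \<in> {1..m} \<Longrightarrow> fst (snd (s k)) \<in> carrier (G k)"
  and t_val: "k \<in> {1..m} \<Longrightarrow> fst (snd (t k)) \<in> carrier (G k)"
  using s_in[of k] t_in[of k] by auto

lemma A_Suc:
  assumes "1 \<le> k" "k < m"
  shows "A (Suc k) X = contact_step k (factor k X)"
proof -
  interpret group "G (Suc k)" using assms group by simp
  have "A (Suc k) X = snd ` ((factor k X \<times> carrier (G (Suc k))) \<inter> V k)"
    using assms by (simp add: theta_B_def factor_def Let_def)
  also have "\<dots> = contact_step k (factor k X)"
    unfolding contact_step_def by (intro image_cong) auto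
  finally show ?thesis .
qed

lemma A_Suc_subset:
  assumes "1 \<le> k" "k < m"
  shows "A (Suc k) X \<subseteq> carrier (G (Suc k))"
  using assms by (auto simp: theta_B_def Let_def)

lemma factor_Suc:
  assumes "1 \<le> k" "k < m"
  shows "factor (Suc k) X = invert_step (Suc k) (A (Suc k) X)"
proof -
  interpret group "G (Suc k)" using assms group by simp
  have a: "fst (snd (s (Suc k))) \<in> carrier (G (Suc k))" "fst (snd (t (Suc k))) \<in> carrier (G (Suc k))"
    using assms s_val t_val by auto
  have "x \<otimes>\<^bsub>G (Suc k)\<^esub> fst (snd (s (Suc k))) \<otimes>\<^bsub>G (Suc k)\<^esub> (inv\<^bsub>G (Suc k)\<^esub> fst (snd (s (Suc k))) \<otimes>\<^bsub>G (Suc k)\<^esub> fst (snd (t (Suc k))))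
     = x \<otimes>\<^bsub>G (Suc k)\<^esub> fst (snd (t (Suc k)))" if "x \<in> carrier (G (Suc k))" for x
    using that a by (metis inv_closed inv_solve_left m_assoc m_closed)
  then have "invert_step (Suc k) (A (Suc k) X) = (\<lambda>x. inv\<^bsub>G (Suc k)\<^esub> (fst (snd (s (Suc k)))) \<otimes>\<^bsub>G (Suc k)\<^esub> inv\<^bsub>G (Suc k)\<^esub> x
      \<otimes>\<^bsub>G (Suc k)\<^esub> fst (snd (t (Suc k)))) ` A (Suc k) X"
    unfolding invert_step_def using a A_Suc_subset[OF assms, of X] by (intro image_cong) auto
  then show ?thesis using assms(1) by (auto simp: factor_def)
qed

lemma snd_hom: "snd \<in> hom (P k) (dual_group (G (Suc k)))"
  by (auto simp: hom_def contact_group_def)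

lemma W_subgroup:
  assumes "1 \<le> k" "k < m"
  shows "subgroup (W k) (P k)"
proof -
  interpret contact E C "D k" "D (Suc k)" by (rule contact[OF assms])
  show ?thesis using s_in[of k] s_in[of "Suc k"] assms by (intro subgroup_vertex_group) auto
qed

lemma V_cases:
  assumes "1 \<le> k" "k < m"
  obtains "V k = {}" | g where "g \<in> carrier (P k)" "V k = W k #>\<^bsub>P k\<^esub> g"
proof -
  interpret contact E C "D k" "D (Suc k)" by (rule contact[OF assms])
  show ?thesis by (rule walk_coset_cases) (use that in auto)
qed

section \<open>Cosets along the chain\<close>

lemma is_right_coset_step:
  assumes "1 \<le> k" "k < m" "is_right_coset fg (G k) Z"
    and "fg \<longrightarrow> rel_Howson (P k) (W k) (tall_subgroups (G k) (G (Suc k)))"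
  shows "contact_step k Z = {} \<or> is_right_coset fg (dual_group (G (Suc k))) (contact_step k Z)"
  using assms(1,2)
proof (cases rule: V_cases)
  case (2 g)
  interpret contact E C "D k" "D (Suc k)" by (rule contact[OF assms(1,2)])
  interpret group_hom "P k" "dual_group (G (Suc k))" snd
    using snd_hom is_group group.group_dual_group[OF group2]
    by (simp add: group_hom_def group_hom_axioms_def)
  show ?thesis
    unfolding contact_step_def 2(2)
    using is_right_coset_image[OF is_right_coset_Int_tall[OF group1 group.group_dual_group[OF group2] assms(3),
       folded contact_group_def, OF W_subgroup[OF assms(1,2)] 2(1)]] assms(4)
      monoid.one_closed[OF group.is_monoid[OF group2]] by auto
qed (simp add: contact_step_def)

lemma is_right_coset_turn:
  assumes "k \<in> {1..m}" "is_right_coset fg (dual_group (G k)) Z"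
  shows "is_right_coset fg (G k) (invert_step k Z)"
proof -
  interpret group "G k" by (rule group[OF assms(1)])
  interpret group_hom "dual_group (G k)" "G k"
    "\<lambda>z. inv\<^bsub>G k\<^esub> (fst (snd (s k))) \<otimes>\<^bsub>G k\<^esub> inv\<^bsub>G k\<^esub> z \<otimes>\<^bsub>G k\<^esub> fst (snd (s k))"
    using inverse_conjugation_hom[OF s_val[OF assms(1)]]
    by (simp add: group_hom_def group_hom_axioms_def is_group)
  show ?thesis
    unfolding invert_step_def using s_val[OF assms(1)] t_val[OF assms(1)]
    by (intro is_right_coset_image assms(2)) simp
qed

lemma is_right_coset_A:
  assumes X: "is_right_coset fg (G 1) X"
    and RHP: "fg \<longrightarrow> (\<forall>k. 1 \<le> k \<and> k < m \<longrightarrow> rel_Howson (P k) (W k) (tall_subgroups (G k) (G (Suc k))))"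
    and "k \<in> {1..m}"
  shows "A k X = {} \<or> is_right_coset fg (dual_group (G k)) (A k X)"
proof -
  \<comment> \<open>The induction follows \<open>factor k X\<close> instead of \<open>A k X\<close>:
    these are cosets on the same side for all \<open>k\<close>, and the missing inversion at
    \<open>k = 1\<close> is absorbed by the base case.\<close>
  have factor: "factor k X = {} \<or> is_right_coset fg (G k) (factor k X)" if "1 \<le> k" "k \<le> m" for k
    using that
  proof (induction k rule: dec_induct)
    case base
    then show ?case using X by (simp add: factor_def)
  next
    case (step k)
    then have k: "1 \<le> k" "k < m" by auto
    show ?case
      unfolding factor_Suc[OF k] A_Suc[OF k]
      using step.IH k is_right_coset_step[OF k, of fg "factor k X"] RHP is_right_coset_turn[of "Suc k" fg]
      by (auto simp: invert_step_def contact_step_def)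
  qed
  show ?thesis
  proof (cases "k = 1")
    case True
    then show ?thesis using X group.is_right_coset_dual_group[OF group] assms(3) by simp
  next
    case False
    then obtain n where n: "k = Suc n" "1 \<le> n" "n < m" using assms(3) by (cases k) auto
    then show ?thesis
      unfolding n(1) A_Suc[OF n(2,3)]
      using factor[of n] is_right_coset_step[OF n(2,3), of fg "factor n X"] RHP by (auto simp: contact_step_def)
  qed
qed

section \<open>Algorithms along the chain\<close>

lemma right_coset_computable_step:
  assumes k: "1 \<le> k" "k < m"
    and "eRHP (P k) (W k) (tall_subgroups (G k) (G (Suc k)))"
    and "RCIP (P k) (W k) (tall_subgroups (G k) (G (Suc k)))"
    and "gen_list (G k) X" "gen_list (G (Suc k)) X'"
  shows "right_coset_computable (G k) X (dual_group (G (Suc k))) X' (contact_step k)"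
  using k
proof (cases rule: V_cases)
  \<comment> \<open>Whether a walk exists does not depend on the input, so this case distinction is
    made outside the algorithm and need not be decided by it.\<close>
  case 1
  then show ?thesis by (simp add: contact_step_def[abs_def] right_coset_computable_empty)
next
  case (2 g)
  interpret contact E C "D k" "D (Suc k)" by (rule contact[OF k])
  have "set X \<subseteq> carrier (G k)" using assms(5) by (simp add: gen_list_def)
  then show ?thesis
    unfolding contact_step_def[abs_def] 2(2) contact_group_def
    using 2(1) W_subgroup[OF k] assms(3,4,6) snd_hom[of k]
    \<comment> \<open>The second factor of the contact group is the dual group, so the carrier of
      \<open>G (Suc k)\<close> is first written as that of its dual.\<close>
    by (subst carrier_dual_group[symmetric], intro right_coset_computable_Int_tall)
      (simp_all add: contact_group_def group1 group2 group.group_dual_group monoid.one_closed group.is_monoid)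
qed

lemma right_coset_computable_turn:
  assumes "k \<in> {1..m}" "gen_list (G k) X" "gen_list (G k) X'"
  shows "right_coset_computable (dual_group (G k)) X (G k) X' (invert_step k)"
proof -
  interpret group "G k" by (rule group[OF assms(1)])
  show ?thesis
    unfolding invert_step_def[abs_def]
    using inverse_conjugation_hom[OF s_val[OF assms(1)]] assms(2,3) s_val[OF assms(1)] t_val[OF assms(1)]
    by (intro right_coset_computable_hom) (simp_all add: is_group gen_list_def)
qed

lemma left_coset_computable_A:
  assumes "1 \<le> m" and alg: "\<And>k. \<lbrakk>1 \<le> k; k < m\<rbrakk> \<Longrightarrow>
      eRHP (P k) (W k) (tall_subgroups (G k) (G (Suc k))) \<and>
      RCIP (P k) (W k) (tall_subgroups (G k) (G (Suc k)))"
  shows "left_coset_computable (G 1) (G m) (A m)"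
proof -
  have G1: "group (G 1)" and Gm: "group (G m)" using group assms(1) by auto
  \<comment> \<open>eRHP provides a generating list of the direct product, and its first coordinates
    generate \<open>G k\<close>.\<close>
  have ex: "\<exists>X. gen_list (G k) X" if k: "1 \<le> k" "k < m" for k
  proof -
    interpret contact E C "D k" "D (Suc k)" by (rule contact[OF k])
    obtain X where X: "gen_list (P k) X" using alg[OF k] by (auto simp: eRHP_def)
    have "fst ` carrier (P k) = carrier (G k)"
      using group.subgroup_self[OF group2, THEN subgroup.one_closed]
      by (force simp: carrier_contact)
    moreover have "fst \<in> hom (P k) (G k)" by (auto simp: hom_def contact_group_def)
    ultimately show ?thesis using gen_list_hom_image[OF group1 _ _ X] by blast
  qed
  \<comment> \<open>The target list stays arbitrary: the induction step chooses its own list of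
    \<open>G k\<close>, while the list of the next group is prescribed.\<close>
  have factor: "right_coset_computable (G 1) X (G k) X' (factor k)"
    if X: "gen_list (G 1) X" and "1 \<le> k" "k \<le> m" "gen_list (G k) X'" for k X X'
    using that(2-)
  proof (induction k arbitrary: X' rule: dec_induct)
    case base
    \<comment> \<open>Even the identity needs an algorithm, because \<open>X\<close> and
      \<open>X'\<close> may be different lists of \<open>G 1\<close>.\<close>
    have "right_coset_computable (G 1) X (G 1) X' (\<lambda>Z. (\<lambda>z. id z \<otimes>\<^bsub>G 1\<^esub> \<one>\<^bsub>G 1\<^esub>) ` Z)"
      using X base G1 group.is_monoid[OF G1]
      by (intro right_coset_computable_hom) (auto simp: hom_def gen_list_def monoid.one_closed)
    moreover have "set X \<subseteq> carrier (G 1)" using X by (simp add: gen_list_def)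
    moreover have "(\<lambda>z. id z \<otimes>\<^bsub>G 1\<^esub> \<one>\<^bsub>G 1\<^esub>) ` Z = factor 1 Z" if "Z \<subseteq> carrier (G 1)" for Z
      using that monoid.r_one[OF group.is_monoid[OF G1]]
      by (force simp: factor_def subset_iff image_iff simp del: One_nat_def)
    ultimately show ?case
      by (rule group.right_coset_computable_cong[OF G1])
  next
    case (step k)
    then have k: "1 \<le> k" "k < m" by auto
    obtain Z where Z: "gen_list (G k) Z" using ex[OF k] by blast
    have "right_coset_computable (G 1) X (G k) Z (factor k)"
      using step.IH[OF _ Z] k by simp
    from right_coset_computable_comp[OF this right_coset_computable_step[OF k _ _ Z step.prems(2)]]
    have "right_coset_computable (G 1) X (dual_group (G (Suc k))) X' (A (Suc k))"
      unfolding A_Suc[OF k, abs_def] using alg[OF k] by (simp add: contact_step_def)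
    from right_coset_computable_comp[OF this right_coset_computable_turn[OF _ step.prems(2,2)]]
    show ?case
      using k by (simp add: invert_step_def factor_Suc[OF k, abs_def])
  qed
  have "right_coset_computable (G 1) X (dual_group (G m)) X' (A m)"
    if X: "gen_list (G 1) X" and X': "gen_list (G m) X'" for X X'
  proof (cases "m = 1")
    \<comment> \<open>No contact step occurs, so the input coset itself has to change sides, by
      conjugating its subgroup.\<close>
    case True
    then show ?thesis
      using group.right_coset_computable_dual_group[OF G1, of X X'] X X' by (simp add: gen_list_def)
  next
    case False
    then obtain n where n: "m = Suc n" "1 \<le> n" "n < m" using assms(1) by (cases m) auto
    obtain Z where Z: "gen_list (G n) Z" using ex[OF n(2,3)] by blast
    have "gen_list (G (Suc n)) X'" using X' n(1) by simp
    from right_coset_computable_comp[OF factor[OF X n(2) _ Z] right_coset_computable_step[OF n(2,3) _ _ Z this]]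
    have "right_coset_computable (G 1) X (dual_group (G (Suc n))) X' (A (Suc n))"
      unfolding A_Suc[OF n(2,3), abs_def] using alg[OF n(2,3)] n(3) by (simp add: contact_step_def)
    then show ?thesis by (simp add: n(1))
  qed
  then show ?thesis by (rule group.left_coset_computableI[OF Gm])
qed

end

text \<open>Makes the coordinate systems available: \<open>C\<close> is assumed to be valid on
  regular D-classes only.\<close>

lemma fingerprint_product_regular:
  assumes "fingerprint_product E C m D t u" "k \<in> {1..m}"
  shows "regular_Dclass (IG E) (D k)"
  using assms unfolding fingerprint_product_def minimal_r_factorisation_def regular_Dclass_def
  by metis

theorem theorem3p8:
  fixes E :: "'e palg"
    and C :: "'e list set set \<Rightarrow> ('g, 'i, 'l, 'e list set) coords"
    and D :: "nat \<Rightarrow> 'e list set set"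
    and m :: nat
    and i j :: "nat \<Rightarrow> 'i" and a b :: "nat \<Rightarrow> 'g" and l \<mu> :: "nat \<Rightarrow> 'l"
    and u v :: "'e list set"
  assumes "biordered_set TYPE('s) E" and "finite (carrier E)"
    and "\<And>K. regular_Dclass (IG E) K \<Longrightarrow> rees_coordinates (IG E) K (C K)"
    and "m \<ge> 1"
    and "fingerprint_product E C m D (\<lambda>k. (i k, a k, l k)) u"
    and "fingerprint_product E C m D (\<lambda>k. (j k, b k, \<mu> k)) v"
  shows "(\<forall>L x. subgroup L (grp (C (D 1))) \<and> x \<in> carrier (grp (C (D 1))) \<longrightarrow>
            (let \<Theta> = theta E C m D (\<lambda>k. (i k, a k, l k)) (\<lambda>k. (j k, b k, \<mu> k))
                       (L #>\<^bsub>grp (C (D 1))\<^esub> x)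
             in \<Theta> = {} \<or> (\<exists>M y. subgroup M (grp (C (D m))) \<and> y \<in> carrier (grp (C (D m))) \<and>
                                \<Theta> = y <#\<^bsub>grp (C (D m))\<^esub> M)))
       \<and> ((\<forall>k. 1 \<le> k \<and> k < m \<longrightarrow>
              rel_Howson (contact_group C (D k) (D (Suc k)))
                (vertex_group E C (D k) (D (Suc k)) (l k, i (Suc k)))
                (tall_subgroups (grp (C (D k))) (grp (C (D (Suc k)))))) \<longrightarrow>
          (\<forall>L x. subgroup L (grp (C (D 1))) \<and> fin_gen (grp (C (D 1))) L \<and>
                 x \<in> carrier (grp (C (D 1))) \<longrightarrow>
            (let \<Theta> = theta E C m D (\<lambda>k. (i k, a k, l k)) (\<lambda>k. (j k, b k, \<mu> k))
                       (L #>\<^bsub>grp (C (D 1))\<^esub> x)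
             in \<Theta> = {} \<or> (\<forall>M y. subgroup M (grp (C (D m))) \<and> y \<in> carrier (grp (C (D m))) \<and>
                                \<Theta> = y <#\<^bsub>grp (C (D m))\<^esub> M \<longrightarrow>
                                fin_gen (grp (C (D m))) M))))
       \<and> ((\<forall>k. 1 \<le> k \<and> k < m \<longrightarrow>
              eRHP (contact_group C (D k) (D (Suc k)))
                (vertex_group E C (D k) (D (Suc k)) (l k, i (Suc k)))
                (tall_subgroups (grp (C (D k))) (grp (C (D (Suc k))))) \<and>
              RCIP (contact_group C (D k) (D (Suc k)))
                (vertex_group E C (D k) (D (Suc k)) (l k, i (Suc k)))
                (tall_subgroups (grp (C (D k))) (grp (C (D (Suc k)))))) \<longrightarrow>
          left_coset_computable (grp (C (D 1))) (grp (C (D m)))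
            (theta E C m D (\<lambda>k. (i k, a k, l k)) (\<lambda>k. (j k, b k, \<mu> k))))"
proof -
  let ?s = "\<lambda>k. (i k, a k, l k)" and ?t = "\<lambda>k. (j k, b k, \<mu> k)"
  have D: "regular_Dclass (IG E) (D k)" if "k \<in> {1..m}" for k
    using fingerprint_product_regular assms(5) that by blast
  have coords: "rees_coordinates (IG E) (D k) (C (D k))" if "k \<in> {1..m}" for k
    using assms(3) D that by blast
  interpret contact_chain E C D m ?s ?t
  proof (rule contact_chain.intro)
    show "group (grp (C (D k)))" if "k \<in> {1..m}" for k
      using coords[OF that] by (simp add: rees_coordinates_def)
    show "?s k \<in> rows (C (D k)) \<times> carrier (grp (C (D k))) \<times> cols (C (D k))"
      "?t k \<in> rows (C (D k)) \<times> carrier (grp (C (D k))) \<times> cols (C (D k))" if "k \<in> {1..m}" for k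
      using assms(5,6) that unfolding fingerprint_product_def by blast+
    show "contact E C (D k) (D (Suc k))" if "1 \<le> k" "k < m" for k
    proof -
      have k: "k \<in> {1..m}" "Suc k \<in> {1..m}" using that by auto
      show ?thesis
        using coords[OF k(1)] coords[OF k(2)]
          beta_closed[where C = C, OF assms(1) D[OF k(1)] coords[OF k(1)]]
          alpha_closed[where C = C, OF assms(1) D[OF k(2)] coords[OF k(2)]]
        by (intro contact.intro) (auto simp: rees_coordinates_def)
    qed
  qed
  interpret Gm: group "grp (C (D m))" using group assms(4) by simp
  have theta: "theta E C m D ?s ?t X = A m X" for X by (simp add: theta_def)
  \<comment> \<open>With \<open>fg = False\<close> the Howson premise is vacuous and (1) results;
    \<open>fg = True\<close> gives (2).\<close>
  have coset: "A m (L #>\<^bsub>grp (C (D 1))\<^esub> x) = {} \<or>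
      is_right_coset fg (dual_group (grp (C (D m)))) (A m (L #>\<^bsub>grp (C (D 1))\<^esub> x))"
    if "subgroup L (grp (C (D 1)))" "fg \<longrightarrow> fin_gen (grp (C (D 1))) L" "x \<in> carrier (grp (C (D 1)))"
      "fg \<longrightarrow> (\<forall>k. 1 \<le> k \<and> k < m \<longrightarrow> rel_Howson (P k) (W k) (tall_subgroups (G k) (G (Suc k))))"
    for L x fg
    using that assms(4) by (intro is_right_coset_A) (auto simp: is_right_coset_def)
  show ?thesis
  proof (intro conjI impI allI, goal_cases)
    case (1 L x)
    then show ?case
      using coset[of L False x] by (auto simp: theta Let_def is_right_coset_def)
  next
    case (2 L x)
    then have "A m (L #>\<^bsub>grp (C (D 1))\<^esub> x) = {} \<or>
      is_right_coset True (dual_group (grp (C (D m)))) (A m (L #>\<^bsub>grp (C (D 1))\<^esub> x))"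
      by (intro coset) auto
    moreover have "fin_gen (grp (C (D m))) M"
      if M: "subgroup M (grp (C (D m)))" "y \<in> carrier (grp (C (D m)))" "Z = y <#\<^bsub>grp (C (D m))\<^esub> M"
        and Z: "is_right_coset True (dual_group (grp (C (D m)))) Z" for M y Z
    proof -
      obtain N z where N: "subgroup N (grp (C (D m)))" "fin_gen (grp (C (D m))) N"
        "z \<in> carrier (grp (C (D m)))" "Z = z <#\<^bsub>grp (C (D m))\<^esub> N"
        using Z by (auto simp: is_right_coset_def)
      \<comment> \<open>In the dual group \<open>y M\<close> and \<open>z N\<close> are right
        cosets, so the uniqueness lemma applies there.\<close>
      have "M = N"
        using group.r_coset_subgroup_unique[OF Gm.group_dual_group, of M N y z] M N by simp
      then show ?thesis using N(2) by simp
    qed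
    ultimately show ?case unfolding theta Let_def by blast
  next
    case 3
    then show ?case
      using left_coset_computable_A[OF assms(4)] by (simp add: theta[abs_def])
  qed
qed

end
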